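(* Let $n \in \mathbb{N}$, $a > 0$ and $b\in\mathbb{C}$ with $\operatorname{Re} b > 0$. Then $$\int_0^\infty \ln(ax)\,\operatorname{sech}^n(bx)\, dx = \frac{2^{n-2}\,\Gamma^2\left(\frac{n}{2}\right)\ln\left(\frac{a}{b}\right)}{b\,(n-1)!} + \frac{2^{2n-1}}{b\,(n-1)!} \sum_{k=2}^{n+1} \left(-\frac{1}{2}\right)^{k} P_{k-2}\left(n-1, \frac{n}{2}\right) \left[\zeta'\left(k-n, \frac{n}{4}\right) - \zeta'\left(k-n, \frac{n+2}{4} \right) - \left(\gamma + \ln 4\right)\left(\zeta\left(k-n, \frac{n}{4}\right) - \zeta\left(k-n, \frac{n+2}{4}\right)\right)\right].$$
   Context: $\mathbb{N}=\{1,2,3,\ldots\}$; $\gamma$ is Euler's constant; $\ln$ is the principal logarithm. $(a)_n := a(a+1)\cdots(a+n-1)$ is the rising factorial, with $(a)_0=1$. Signed generalized Stirling polynomials of the first kind: for $m\in\mathbb{N}_0$ and $x\in\mathbb{C}$, $P_k(m,x)$, $0\le k\le m$, are defined by the polynomial identity in $j$ $$(j+1)_m = \sum_{k=0}^m (-1)^k P_k(m, x)\,(j + x)^{m-k}.$$ $\zeta(s,z)$ is the Hurwitz zeta function, $\zeta(s,z)=\sum_{n\ge0}(n+z)^{-s}$ for $\operatorname{Re}s>1$, continued analytically to $s\in\mathbb{C}\setminus\{1\}$, and $\zeta'(s,z)=\frac{\partial}{\partial s}\zeta(s,z)$. At $s=1$ the differences are understood as limits: for $q\in\{0,1\}$,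 $$\zeta^{(q)}(1,x)-\zeta^{(q)}\left(1,x+\tfrac12\right):=\lim_{s\to1}\left[\zeta^{(q)}(s,x)-\zeta^{(q)}\left(s,x+\tfrac12\right)\right],$$ where $\zeta^{(0)}=\zeta$, $\zeta^{(1)}=\zeta'$. *)

theory Defs
  imports "HOL-Complex_Analysis.Complex_Analysis"
begin

definition sech :: "'a::{real_normed_field, banach} \<Rightarrow> 'a" where
  "sech z = 1 / cosh z"


section \<open>Signed generalized Stirling polynomials of the first kind\<close>

text \<open>
  The coefficient family is unique on indices \<open>0..m\<close> only, so the value is meaningful for
  \<open>k \<le> m\<close> and unspecified otherwise; see \<open>stirling_poly_identity\<close> and \<open>stirling_poly_unique\<close>.
\<close>

definition stirling_poly :: "nat \<Rightarrow> nat \<Rightarrow> complex \<Rightarrow> complex" where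
  "stirling_poly k m x =
     (THE c. \<exists>P. (\<forall>j. pochhammer (j + 1) m = (\<Sum>i=0..m. (-1) ^ i * P i * (j + x) ^ (m - i))) \<and>
                 P k = c)"

lemma stirling_family_exists:
  fixes x :: complex
  shows "\<exists>P. \<forall>j. pochhammer (j + 1) m = (\<Sum>i=0..m. (-1) ^ i * P i * (j + x) ^ (m - i))"
proof -
  define q where "q = (\<Prod>i=0..<m. [:1 - x + of_nat i, 1:])"
  have deg: "degree q = m"
    unfolding q_def by (subst degree_prod_eq_sum_degree) auto
  have q: "poly q (j + x) = pochhammer (j + 1) m" for j
    unfolding q_def by (simp add: poly_prod pochhammer_prod algebra_simps)
  have "pochhammer (j + 1) m
      = (\<Sum>i=0..m. (-1) ^ i * ((-1) ^ i * coeff q (m - i)) * (j + x) ^ (m - i))" for j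
  proof -
    have "pochhammer (j + 1) m = (\<Sum>i=0..m. coeff q i * (j + x) ^ i)"
      by (simp add: q [symmetric] poly_altdef deg atMost_atLeast0)
    also have "\<dots> = (\<Sum>i=0..m. coeff q (m - i) * (j + x) ^ (m - i))"
      by (rule sum.reindex_bij_witness[of _ "\<lambda>i. m - i" "\<lambda>i. m - i"]) auto
    also have "\<dots> = (\<Sum>i=0..m. (-1) ^ i * ((-1) ^ i * coeff q (m - i)) * (j + x) ^ (m - i))"
      by (intro sum.cong refl) (simp add: mult.assoc [symmetric] power_mult_distrib [symmetric])
    finally show ?thesis .
  qed
  then show ?thesis
    by (intro exI[of _ "\<lambda>i. (-1) ^ i * coeff q (m - i)"]) blast
qed

lemma stirling_family_unique:
  fixes x :: complex
  assumes P: "\<And>j. pochhammer (j + 1) m = (\<Sum>i=0..m. (-1) ^ i * P i * (j + x) ^ (m - i))"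
    and Q: "\<And>j. pochhammer (j + 1) m = (\<Sum>i=0..m. (-1) ^ i * Q i * (j + x) ^ (m - i))"
    and "k \<le> m"
  shows "P k = Q k"
proof -
  define pol where "pol R = (\<Sum>i=0..m. monom ((-1) ^ i * R i) (m - i))" for R :: "nat \<Rightarrow> complex"
  have eval: "poly (pol R) y = (\<Sum>i=0..m. (-1) ^ i * R i * y ^ (m - i))" for R y
    by (simp add: pol_def poly_sum poly_monom)
  have "poly (pol P) y = poly (pol Q) y" for y
    using P[of "y - x"] Q[of "y - x"] by (simp add: eval)
  then have "pol P = pol Q"
    by (simp add: poly_eq_poly_eq_iff [symmetric] fun_eq_iff)
  moreover have "coeff (pol R) (m - k) = (-1) ^ k * R k" for R
  proof -
    have "coeff (pol R) (m - k) = (\<Sum>i=0..m. if i = k then (-1) ^ i * R i else 0)"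
      unfolding pol_def coeff_sum using \<open>k \<le> m\<close> by (intro sum.cong refl) auto
    then show ?thesis
      using \<open>k \<le> m\<close> by simp
  qed
  ultimately have "(-1) ^ k * P k = (-1) ^ k * Q k"
    by metis
  then show ?thesis
    by simp
qed

lemma stirling_poly_unique:
  assumes "\<And>j. pochhammer (j + 1) m = (\<Sum>i=0..m. (-1) ^ i * P i * (j + x) ^ (m - i))"
    and "k \<le> m"
  shows "stirling_poly k m x = P k"
  unfolding stirling_poly_def
  by (rule the_equality) (use assms stirling_family_unique in blast)+

lemma stirling_poly_identity:
  "pochhammer (j + 1) m = (\<Sum>k=0..m. (-1) ^ k * stirling_poly k m x * (j + x) ^ (m - k))"
proof -
  obtain P where
    P: "\<And>j. pochhammer (j + 1) m = (\<Sum>i=0..m. (-1) ^ i * P i * (j + x) ^ (m - i))"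
    using stirling_family_exists by blast
  show ?thesis
    by (subst P) (simp add: stirling_poly_unique[OF P])
qed


section \<open>The Hurwitz zeta function\<close>

text \<open>
  The value at \<open>s \<noteq> 1\<close> is that of the analytic continuation of the Dirichlet series to the
  punctured plane, which is unique by \<open>hurwitz_zeta_eqI\<close>; at the pole \<open>s = 1\<close> it is unspecified.
  Powers are taken with the principal logarithm.
\<close>

definition hurwitz_zeta :: "complex \<Rightarrow> complex \<Rightarrow> complex" where
  "hurwitz_zeta s z =
     (THE w. \<exists>f. f holomorphic_on - {1} \<and>
                 (\<forall>t. Re t > 1 \<longrightarrow> (\<lambda>n. (of_nat n + z) powr (- t)) sums f t) \<and>
                 f s = w)"

lemma hurwitz_zeta_eqI:
  assumes f: "f holomorphic_on - {1}"
    and f_sums: "\<And>t. Re t > 1 \<Longrightarrow> (\<lambda>n. (of_nat n + z) powr (- t)) sums f t"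
    and "s \<noteq> 1"
  shows "hurwitz_zeta s z = f s"
  unfolding hurwitz_zeta_def
proof (rule the_equality)
  show "\<exists>g. g holomorphic_on - {1} \<and>
            (\<forall>t. Re t > 1 \<longrightarrow> (\<lambda>n. (of_nat n + z) powr (- t)) sums g t) \<and> g s = f s"
    using f f_sums by blast
next
  fix w
  assume "\<exists>g. g holomorphic_on - {1} \<and>
            (\<forall>t. Re t > 1 \<longrightarrow> (\<lambda>n. (of_nat n + z) powr (- t)) sums g t) \<and> g s = w"
  then obtain g where g: "g holomorphic_on - {1}"
    and g_sums: "\<And>t. Re t > 1 \<Longrightarrow> (\<lambda>n. (of_nat n + z) powr (- t)) sums g t"
    and w: "g s = w" by blast
  have "g s = f s"
  proof (rule analytic_continuation_open[where f = g and g = f and z = s and s = "{t. Re t > 1}" and s' = "- {1}"])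
    show "open {t. Re t > 1}" by (rule open_halfspace_Re_gt)
    have "2 \<in> {t. Re t > 1}" by simp
    then show "{t. Re t > 1} \<noteq> {}" by blast
    show "connected (- {1::complex})" by (simp add: connected_punctured_universe)
    show "g t = f t" if "t \<in> {t. Re t > 1}" for t
      using that g_sums f_sums sums_unique2 by blast
  qed (use f g \<open>s \<noteq> 1\<close> in auto)
  with w show "w = f s" by simp
qed

text \<open>
  The \<open>q\<close>-th \<open>s\<close>-derivative of \<open>\<zeta>(s, x) - \<zeta>(s, y)\<close>, taken as a limit at \<open>s = 1\<close>, where the
  poles of the two terms cancel.
\<close>

definition hurwitz_zeta_diff :: "nat \<Rightarrow> complex \<Rightarrow> complex \<Rightarrow> complex \<Rightarrow> complex" where
  "hurwitz_zeta_diff q s x y =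
     (let D = (\<lambda>t. (deriv ^^ q) (\<lambda>u. hurwitz_zeta u x) t - (deriv ^^ q) (\<lambda>u. hurwitz_zeta u y) t)
      in if s = 1 then Lim (at 1) D else D s)"

end

theory Submission
  imports Defs
begin

text \<open>
  The integral is read off from a Mellin transform and its derivative at \<open>s = 1\<close>.  Put
  \<open>M(s) = \<integral> x powr (s - 1) * sech (b * x) ^ n\<close> over \<open>x > 0\<close>, which is holomorphic on
  \<open>Re s > 0\<close> because \<open>sech (b * x)\<close> decays exponentially (\<open>norm_sech_line_le\<close>,
  \<open>mellin_transform\<close>); then \<open>M(1) = \<integral> sech (b * x) ^ n\<close> and
  \<open>M'(1) = \<integral> ln x * sech (b * x) ^ n\<close>, so the integral sought is \<open>ln a * M(1) + M'(1)\<close>.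

  For \<open>Re s > n\<close>, expand \<open>sech (b * x) ^ n = 2 ^ n * exp (- n * b * x) / (1 + exp (- 2 * b * x)) ^ n\<close>
  by the binomial series and integrate term by term.  Each term is a Gamma integral with
  the complex rate \<open>(n + 2 * j) * b\<close> (\<open>Gamma_integral_complex_rate\<close>), so the parameter \<open>b\<close> enters only
  through a factor \<open>b powr (- s)\<close>.  The binomial coefficients are
  \<open>pochhammer (j + 1) (n - 1) / (n - 1)!\<close>, and the Stirling polynomials at \<open>n / 2\<close> expand them in powers of
  \<open>j + n / 2\<close>.  What remains are alternating series \<open>\<Sum>j. (- 1) ^ j * (j + n / 2) powr (- w)\<close>;
  splitting by the parity of \<open>j\<close> turns each into \<open>2 powr (- w)\<close> times
  \<open>\<zeta>(w, n / 4) - \<zeta>(w, (n + 2) / 4)\<close> (\<open>hurwitz_alternating_sums\<close>).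

  That difference is an entire function \<open>Q\<close> of \<open>w\<close> (\<open>hurwitz_zeta_diff_entire\<close>), so the resulting
  formula for \<open>M\<close> persists on \<open>Re s > 0\<close> (\<open>sech_power_mellin\<close>) and may be differentiated at
  \<open>s = 1\<close> (\<open>sech_mellin_deriv_1\<close>): the derivative of \<open>Gamma\<close> contributes \<open>- \<gamma>\<close>, the powers of
  two contribute \<open>- ln 4\<close>, and \<open>b powr (- s)\<close> contributes \<open>- ln b\<close>, which joins \<open>ln a\<close>.  The value \<open>M(1)\<close>
  is proportional to \<open>1 / b\<close>, and for \<open>b = 1\<close> it is found from the reduction formula for \<open>\<integral> sech x ^ n\<close>
  (\<open>integral_sech_power\<close>).

  The remaining ingredient is the continuation of the Hurwitz zeta function.  It rests on the identity
  \<open>\<zeta>(s, x) = x powr (1 - s) / (s - 1) + s * \<integral> (1 - u) * \<zeta>(s + 1, x + u)\<close> over \<open>u \<in> [0, 1]\<close>,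
  which expresses the function by its values one unit further to the right and can be iterated.
\<close>

section \<open>Holomorphic dependence of integrals on a parameter\<close>

text \<open>
  A bound on the integrand alone is enough to differentiate under the integral: by Cauchy's inequality
  \<open>g / r\<close> dominates the derivative on a smaller disc, hence also the difference quotients, and dominated
  convergence applies.
\<close>

lemma has_field_derivative_set_integral:
  fixes f f' :: "complex \<Rightarrow> 'a \<Rightarrow> complex" and g :: "'a \<Rightarrow> real"
  assumes "open U" and "A \<in> sets M" and s: "s \<in> U"
    and deriv: "\<And>s x. s \<in> U \<Longrightarrow> x \<in> A \<Longrightarrow> ((\<lambda>s. f s x) has_field_derivative f' s x) (at s)"
    and meas: "\<And>s. s \<in> U \<Longrightarrow> set_borel_measurable M A (f s)"
    and dom: "\<And>s x. s \<in> U \<Longrightarrow> x \<in> A \<Longrightarrow> norm (f s x) \<le> g x"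
    and g: "set_integrable M A g"
  shows "set_integrable M A (f' s)"
    and "((\<lambda>s. LINT x:A|M. f s x) has_field_derivative (LINT x:A|M. f' s x)) (at s)"
proof -
  obtain e where "e > 0" and e: "ball s e \<subseteq> U"
    using \<open>open U\<close> s openE by blast
  \<comment> \<open>Any radius with \<open>r + r < e\<close> keeps the discs \<open>cball z r\<close>, \<open>z \<in> ball s r\<close>, inside \<open>U\<close>.\<close>
  define r where "r = e / 3"
  have "r > 0" and sub: "\<And>z. z \<in> ball s r \<Longrightarrow> cball z r \<subseteq> U"
  proof -
    show "r > 0" using \<open>e > 0\<close> by (simp add: r_def)
    fix z assume z: "z \<in> ball s r"
    have "cball z r \<subseteq> ball s e"
    proof
      fix w assume "w \<in> cball z r"
      then have "dist s w \<le> dist s z + dist z w" "dist z w \<le> r" "dist s z < r"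
        using z by (auto simp: dist_triangle)
      then show "w \<in> ball s e" using \<open>r > 0\<close> unfolding r_def by simp
    qed
    then show "cball z r \<subseteq> U" using e by blast
  qed
  have inU: "z \<in> U" if "z \<in> ball s r" for z
    using sub[OF that] \<open>r > 0\<close> by (auto simp: subset_iff)
  have bound: "norm (f' z x) \<le> g x / r" if z: "z \<in> ball s r" and x: "x \<in> A" for z x
  proof -
    have hol: "(\<lambda>s. f s x) holomorphic_on cball z r"
      using deriv[OF _ x] sub[OF z] by (auto simp: holomorphic_on_def field_differentiable_def
          intro: has_field_derivative_at_within)
    have "norm ((deriv ^^ 1) (\<lambda>s. f s x) z) \<le> fact 1 * g x / r ^ 1"
    proof (rule Cauchy_inequality)
      show "(\<lambda>s. f s x) holomorphic_on ball z r" using hol holomorphic_on_subset by fastforce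
      show "continuous_on (cball z r) (\<lambda>s. f s x)" using hol holomorphic_on_imp_continuous_on by blast
      show "norm (f w x) \<le> g x" if "cmod (z - w) = r" for w
        using dom[OF _ x] sub[OF z] that by (auto simp: subset_iff dist_norm)
    qed (fact \<open>r > 0\<close>)
    then show ?thesis using DERIV_imp_deriv[OF deriv[OF inU[OF z] x]] by simp
  qed
  define q where "q w x = indicator A x *\<^sub>R ((f w x - f s x) / (w - s))" for w x
  have int: "set_integrable M A (f w)" if "w \<in> U" for w
    using g meas[OF that] by (rule set_integrable_bound) (use dom[OF that] in \<open>auto intro!: AE_I2 intro: order_trans[OF _ abs_ge_self]\<close>)
  have lim: "(\<lambda>i. q (X i) x) \<longlonglongrightarrow> indicator A x *\<^sub>R f' s x"
    if X: "\<forall>i. X i \<in> ball s r - {s}" "X \<longlonglongrightarrow> s" for X x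
  proof (cases "x \<in> A")
    case True
    have "((\<lambda>w. (f w x - f s x) / (w - s)) \<longlongrightarrow> f' s x) (at s within ball s r)"
      using deriv[OF s True] unfolding has_field_derivative_iff by (rule Lim_at_imp_Lim_at_within)
    then show ?thesis using X True unfolding tendsto_at_iff_sequentially q_def comp_def by auto
  qed (simp add: q_def)
  have qbound: "norm (q w x) \<le> indicator A x *\<^sub>R (g x / r)" if w: "w \<in> ball s r - {s}" for w x
  proof (cases "x \<in> A")
    case True
    have "norm (f w x - f s x) \<le> g x / r * norm (w - s)"
    proof (rule field_differentiable_bound)
      show "convex (ball s r)" by simp
      show "((\<lambda>s. f s x) has_field_derivative f' z x) (at z within ball s r)" if "z \<in> ball s r" for z
        using deriv[OF inU[OF that] True] by (rule has_field_derivative_at_within)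
      show "norm (f' z x) \<le> g x / r" if "z \<in> ball s r" for z
        using bound[OF that True] .
    qed (use w \<open>r > 0\<close> in auto)
    then show ?thesis using True w by (simp add: q_def norm_divide divide_le_eq)
  qed (simp add: q_def)
  have qmeas: "q w \<in> borel_measurable M" if "w \<in> U" for w
  proof -
    have "(\<lambda>x. indicator A x *\<^sub>R f w x - indicator A x *\<^sub>R f s x) \<in> borel_measurable M"
      using meas[OF that] meas[OF s] unfolding set_borel_measurable_def by measurable
    then have "(\<lambda>x. (indicator A x *\<^sub>R f w x - indicator A x *\<^sub>R f s x) / (w - s)) \<in> borel_measurable M"
      by measurable
    also have "(\<lambda>x. (indicator A x *\<^sub>R f w x - indicator A x *\<^sub>R f s x) / (w - s)) = q w"
      by (auto simp: q_def fun_eq_iff indicator_def)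
    finally show ?thesis .
  qed
  have gr: "integrable M (\<lambda>x. indicator A x *\<^sub>R (g x / r))"
    using g unfolding set_integrable_def by (auto dest: integrable_divide)
  have *: "set_integrable M A (f' s) \<and> (\<lambda>i. LINT x|M. q (X i) x) \<longlonglongrightarrow> (LINT x:A|M. f' s x)"
    if X: "\<forall>i. X i \<in> ball s r - {s}" "X \<longlonglongrightarrow> s" for X
  proof -
    have m: "q (X i) \<in> borel_measurable M" for i
      using X(1) inU by (intro qmeas) auto
    have m': "(\<lambda>x. indicator A x *\<^sub>R f' s x) \<in> borel_measurable M"
      by (rule borel_measurable_LIMSEQ_metric[OF m lim[OF X]])
    note dc = m' m gr AE_I2[OF lim[OF X]] AE_I2[OF qbound]
    show ?thesis
      unfolding set_integrable_def set_lebesgue_integral_def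
      using integrable_dominated_convergence[OF dc] integral_dominated_convergence[OF dc] X by auto
  qed
  have "(\<lambda>i. s + of_real (r / (2 + of_nat i))) \<longlonglongrightarrow> s + of_real 0"
    by (intro tendsto_add tendsto_const tendsto_of_real) real_asymp
  moreover have "s + of_real (r / (2 + of_nat i)) \<in> ball s r - {s}" for i
  proof -
    have "0 < r / (2 + of_nat i)" "r / (2 + of_nat i) < r"
      using \<open>r > 0\<close> by (simp_all add: field_simps add_pos_nonneg)
    then show ?thesis by (simp add: dist_norm del: of_real_divide)
  qed
  ultimately show "set_integrable M A (f' s)"
    using *[of "\<lambda>i. s + of_real (r / (2 + of_nat i))"] by simp
  have "((\<lambda>w. ((LINT x:A|M. f w x) - (LINT x:A|M. f s x)) / (w - s)) \<longlongrightarrow> (LINT x:A|M. f' s x)) (at s within ball s r)"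
    unfolding tendsto_at_iff_sequentially
  proof (intro allI impI)
    fix X assume X: "\<forall>i. X i \<in> ball s r - {s}" "X \<longlonglongrightarrow> s"
    have "((LINT x:A|M. f (X i) x) - (LINT x:A|M. f s x)) / (X i - s) = (LINT x|M. q (X i) x)" for i
    proof -
      have "X i \<in> U" using X inU by auto
      have "(LINT x|M. q (X i) x) = (LINT x:A|M. (f (X i) x - f s x) / (X i - s))"
        unfolding q_def set_lebesgue_integral_def by (rule refl)
      then show ?thesis
        using int[OF \<open>X i \<in> U\<close>] int[OF s] by (simp only: set_integral_divide_zero set_integral_diff)
    qed
    then show "((\<lambda>w. ((LINT x:A|M. f w x) - (LINT x:A|M. f s x)) / (w - s)) \<circ> X) \<longlonglongrightarrow> (LINT x:A|M. f' s x)"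
      using *[OF X] by (simp add: comp_def)
  qed
  then show "((\<lambda>s. LINT x:A|M. f s x) has_field_derivative (LINT x:A|M. f' s x)) (at s)"
    unfolding has_field_derivative_iff using at_within_open[of s "ball s r"] \<open>r > 0\<close> by simp
qed

section \<open>Mellin transforms and the Gamma integral\<close>

lemma set_borel_measurable_lborel_continuous_on:
  fixes f :: "real \<Rightarrow> 'b::real_normed_vector"
  assumes "A \<in> sets borel" "continuous_on A f"
  shows "set_borel_measurable lborel A f"
  using borel_measurable_continuous_on_indicator[OF assms] by (simp add: set_borel_measurable_def)

lemma set_integrable_powr_exp:
  fixes \<sigma> \<delta> :: real
  assumes "\<sigma> > 0" "\<delta> > 0"
  shows "set_integrable lborel {0<..} (\<lambda>x. x powr (\<sigma> - 1) * exp (- \<delta> * x))"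
proof -
  have "set_integrable lebesgue {0<..} (\<lambda>x. norm (complex_of_real x powr (of_real \<sigma> - 1) / of_real (exp (\<delta> * x))))"
    using absolutely_integrable_Gamma_integral[of "of_real \<sigma>" \<delta>] assms
    by (intro set_integrable_norm) auto
  moreover have "norm (complex_of_real x powr (of_real \<sigma> - 1) / of_real (exp (\<delta> * x))) = x powr (\<sigma> - 1) * exp (- \<delta> * x)"
    if "x \<in> {0<..}" for x
    using that by (simp add: norm_divide norm_powr_real_powr exp_minus field_simps)
  ultimately have "set_integrable lebesgue {0<..} (\<lambda>x. x powr (\<sigma> - 1) * exp (- \<delta> * x))"
    using set_integrable_cong[OF refl refl] by (metis (no_types, lifting))
  moreover have "(\<lambda>x. indicator {0<..} x *\<^sub>R (x powr (\<sigma> - 1) * exp (- \<delta> * x))) \<in> borel_measurable lborel"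
    by measurable
  ultimately show ?thesis
    unfolding set_integrable_def by (simp add: integrable_completion)
qed

text \<open>
  On a disc of radius \<open>r < Re s\<close> about \<open>s\<close> the kernel \<open>x powr (z - 1)\<close> is bounded by the sum of its two extreme
  moduli, one controlling \<open>x \<le> 1\<close> and the other \<open>x \<ge> 1\<close>; both are integrable against the exponential.
\<close>

lemma mellin_transform:
  fixes h :: "real \<Rightarrow> complex"
  assumes h: "continuous_on {0<..} h" and bound: "\<And>x. x > 0 \<Longrightarrow> norm (h x) \<le> C * exp (- \<delta> * x)"
    and "\<delta> > 0" and s: "Re s > 0"
  shows "set_integrable lborel {0<..} (\<lambda>x. of_real x powr (s - 1) * h x)"
    and "set_integrable lborel {0<..} (\<lambda>x. of_real (ln x) * (of_real x powr (s - 1) * h x))"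
    and "((\<lambda>s. LINT x:{0<..}|lborel. of_real x powr (s - 1) * h x) has_field_derivative
          (LINT x:{0<..}|lborel. of_real (ln x) * (of_real x powr (s - 1) * h x))) (at s)"
proof -
  define r where "r = Re s / 2"
  define U where "U = ball s r"
  define g where "g x = C * (x powr ((Re s - r) - 1) * exp (- \<delta> * x) + x powr ((Re s + r) - 1) * exp (- \<delta> * x))" for x
  have "open U" "s \<in> U" using s by (simp_all add: U_def r_def)
  have g: "set_integrable lborel {0<..} g"
    unfolding g_def using s \<open>\<delta> > 0\<close>
    by (intro set_integrable_mult_right set_integral_add set_integrable_powr_exp) (auto simp: r_def)
  have deriv: "((\<lambda>s. of_real x powr (s - 1) * h x) has_field_derivative of_real (ln x) * (of_real x powr (z - 1) * h x)) (at z)"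
    if "x \<in> {0<..}" for z x
    using that unfolding powr_def by (auto intro!: derivative_eq_intros simp: Ln_of_real)
  have meas: "set_borel_measurable lborel {0<..} (\<lambda>x. of_real x powr (z - 1) * h x)" for z
    by (intro set_borel_measurable_lborel_continuous_on continuous_intros h) auto
  have dom: "norm (of_real x powr (z - 1) * h x) \<le> g x" if "z \<in> U" "x \<in> {0<..}" for x z
  proof -
    have "\<bar>Re z - Re s\<bar> < r"
      using that abs_Re_le_cmod[of "z - s"] by (auto simp: U_def dist_norm norm_minus_commute)
    then have "x powr (Re z - 1) \<le> x powr ((Re s - r) - 1) + x powr ((Re s + r) - 1)"
    proof (cases "x \<ge> 1")
      case True
      with \<open>\<bar>Re z - Re s\<bar> < r\<close> have "x powr (Re z - 1) \<le> x powr ((Re s + r) - 1)"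
        by (intro powr_mono) auto
      then show ?thesis by (smt (verit) powr_ge_zero)
    next
      case False
      with \<open>\<bar>Re z - Re s\<bar> < r\<close> that have "x powr (Re z - 1) \<le> x powr ((Re s - r) - 1)"
        by (intro powr_mono') auto
      then show ?thesis by (smt (verit) powr_ge_zero)
    qed
    moreover have "norm (h x) \<le> C * exp (- \<delta> * x)" using bound that by simp
    ultimately have "x powr (Re z - 1) * norm (h x) \<le> (x powr ((Re s - r) - 1) + x powr ((Re s + r) - 1)) * (C * exp (- \<delta> * x))"
      by (intro mult_mono) auto
    then show ?thesis using that by (simp add: norm_mult norm_powr_real_powr g_def algebra_simps)
  qed
  show "set_integrable lborel {0<..} (\<lambda>x. of_real x powr (s - 1) * h x)"
    using g meas by (rule set_integrable_bound)
      (use dom[OF \<open>s \<in> U\<close>] in \<open>auto intro!: AE_I2 intro: order_trans[OF _ abs_ge_self]\<close>)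
  note * = has_field_derivative_set_integral[OF \<open>open U\<close> _ \<open>s \<in> U\<close> deriv meas dom g]
  show "set_integrable lborel {0<..} (\<lambda>x. of_real (ln x) * (of_real x powr (s - 1) * h x))"
    by (rule *) auto
  show "((\<lambda>s. LINT x:{0<..}|lborel. of_real x powr (s - 1) * h x) has_field_derivative
          (LINT x:{0<..}|lborel. of_real (ln x) * (of_real x powr (s - 1) * h x))) (at s)"
    by (rule *) auto
qed

text \<open>
  For a real rate this is the substitution \<open>x \<mapsto> c * x\<close>.  Both sides are holomorphic in \<open>c\<close> on the right
  half-plane, so agreement on the positive reals suffices.
\<close>

lemma Gamma_integral_complex_rate:
  assumes s: "Re s > 0" and c: "Re c > 0"
  shows "(LINT x:{0<..}|lborel. of_real x powr (s - 1) * exp (- c * of_real x)) = Gamma s * c powr (- s)"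
proof -
  define G where "G c = (LINT x:{0<..}|lborel. of_real x powr (s - 1) * exp (- c * of_real x))" for c :: complex
  have meas: "set_borel_measurable lborel {0<..} (\<lambda>x. of_real x powr (s - 1) * exp (- c * of_real x))" for c :: complex
    by (intro set_borel_measurable_lborel_continuous_on continuous_intros) auto
  have int1: "set_integrable lborel {0<..} (\<lambda>x. of_real x powr (s - 1) * exp (- of_real x) :: complex)"
    by (rule mellin_transform(1)[where C = 1 and \<delta> = 1])
      (use s in \<open>auto intro!: continuous_intros simp flip: exp_of_real\<close>)
  have G1: "G 1 = Gamma s"
  proof -
    have "G 1 = integral {0<..} (\<lambda>x. of_real x powr (s - 1) * exp (- of_real x))"
      unfolding G_def using set_borel_integral_eq_integral(2)[OF int1] by simp
    also have "\<dots> = integral {0<..} (\<lambda>x. of_real x powr (s - 1) / of_real (exp x))"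
      by (simp add: exp_minus divide_inverse flip: exp_of_real)
    also have "\<dots> = Gamma s"
      using Gamma_integral_complex'[OF s] by (rule integral_unique)
    finally show ?thesis .
  qed
  have real: "G (of_real t) = Gamma s * of_real t powr (- s)" if "t > 0" for t :: real
  proof -
    have "G 1 = (LINT x|lborel. indicator {0<..} x *\<^sub>R (of_real x powr (s - 1) * exp (- of_real x)))"
      by (simp add: G_def set_lebesgue_integral_def)
    also have "\<dots> = t *\<^sub>R (LINT x|lborel. indicator {0<..} (t * x) *\<^sub>R (of_real (t * x) powr (s - 1) * exp (- of_real (t * x))))"
      using \<open>t > 0\<close> by (subst lborel_integral_real_affine[where c = t and t = 0]) auto
    also have "(\<lambda>x. indicator {0<..} (t * x) *\<^sub>R (of_real (t * x) powr (s - 1) * exp (- of_real (t * x))) :: complex)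
       = (\<lambda>x. of_real t powr (s - 1) * (indicator {0<..} x *\<^sub>R (of_real x powr (s - 1) * exp (- of_real t * of_real x))))"
      using \<open>t > 0\<close> by (auto simp: fun_eq_iff indicator_def zero_less_mult_iff powr_times_real)
    also have "(LINT x|lborel. of_real t powr (s - 1) * (indicator {0<..} x *\<^sub>R (of_real x powr (s - 1) * exp (- of_real t * of_real x))))
       = of_real t powr (s - 1) * G (of_real t)"
      unfolding G_def set_lebesgue_integral_def by (rule integral_mult_right_zero)
    finally have "Gamma s = of_real t powr s * G (of_real t)"
      using \<open>t > 0\<close> by (simp add: G1 powr_diff scaleR_conv_of_real)
    then show ?thesis using \<open>t > 0\<close> by (simp add: powr_minus field_simps)
  qed
  have hol: "G holomorphic_on {c. Re c > 0}"
  proof (rule holomorphic_onI)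
    fix c :: complex assume "c \<in> {c. Re c > 0}"
    then have "Re c > 0" by simp
    define \<delta> where "\<delta> = Re c / 2"
    define U where "U = {c. Re c > \<delta>}"
    have "open U" unfolding U_def by (rule open_halfspace_Re_gt)
    have "c \<in> U" "\<delta> > 0" using \<open>Re c > 0\<close> by (auto simp: U_def \<delta>_def)
    have deriv: "((\<lambda>c. of_real x powr (s - 1) * exp (- c * of_real x)) has_field_derivative
        - of_real x * (of_real x powr (s - 1) * exp (- c * of_real x))) (at c)" for c :: complex and x :: real
      by (auto intro!: derivative_eq_intros)
    have dom: "norm (of_real x powr (s - 1) * exp (- c * of_real x)) \<le> x powr (Re s - 1) * exp (- \<delta> * x)"
      if "c \<in> U" "x \<in> {0<..}" for c x
      using that by (auto simp: norm_mult norm_powr_real_powr U_def intro!: mult_left_mono)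
    have "(G has_field_derivative (LINT x:{0<..}|lborel. - of_real x * (of_real x powr (s - 1) * exp (- c * of_real x)))) (at c)"
      unfolding G_def
      by (rule has_field_derivative_set_integral(2)[OF \<open>open U\<close> _ \<open>c \<in> U\<close> deriv meas dom])
        (use set_integrable_powr_exp[OF s \<open>\<delta> > 0\<close>] in auto)
    then show "G field_differentiable at c within {c. Re c > 0}"
      using field_differentiable_at_within field_differentiable_def by blast
  qed
  have "G c - Gamma s * c powr (- s) = 0"
  proof (rule analytic_continuation[where S = "{c. Re c > 0}" and U = "of_real ` {0<..}" and \<xi> = 1 and f = "\<lambda>c. G c - Gamma s * c powr (- s)"])
    show "(\<lambda>c. G c - Gamma s * c powr (- s)) holomorphic_on {c. Re c > 0}"
      by (intro holomorphic_intros hol) (auto simp: complex_nonpos_Reals_iff)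
    show "connected {c. Re c > 0}"
      by (intro convex_connected convex_halfspace_Re_gt)
    show "1 islimpt (of_real ` {0<..} :: complex set)"
    proof (rule islimptI)
      fix T :: "complex set" assume "1 \<in> T" "open T"
      then obtain e where "e > 0" and e: "ball 1 e \<subseteq> T" using openE by blast
      have "of_real (1 + e / 2) \<in> ball (1::complex) e"
        using \<open>e > 0\<close> by (simp add: dist_norm)
      with e \<open>e > 0\<close> show "\<exists>y\<in>of_real ` {0<..}. y \<in> T \<and> y \<noteq> (1::complex)"
        by (intro bexI[of _ "of_real (1 + e / 2)"]) (auto simp del: of_real_add of_real_divide simp: of_real_eq_1_iff)
    qed
  qed (use c real in \<open>auto simp: open_halfspace_Re_gt\<close>)
  then show ?thesis by (simp add: G_def)
qed

section \<open>Analytic continuation of the Hurwitz zeta function\<close>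

text \<open>
  This is \<open>\<zeta>(s, x + 1)\<close>.  Dropping the first term of \<open>\<zeta>(s, x)\<close> leaves terms with base at least \<open>1\<close>, which are
  dominated by \<open>(n + 1) powr (- \<tau>)\<close> uniformly for \<open>Re s \<ge> \<tau>\<close> and all \<open>x > 0\<close>.
\<close>

definition zeta_tail :: "complex \<Rightarrow> real \<Rightarrow> complex" where
  "zeta_tail s x = (\<Sum>n. of_real (real n + 1 + x) powr (- s))"

lemma norm_zeta_tail_term_le:
  assumes "x > 0" "Re s \<ge> \<tau>" "\<tau> \<ge> 0"
  shows "norm (of_real (real n + 1 + x) powr (- s) :: complex) \<le> (real n + 1) powr (- \<tau>)"
proof -
  have "norm (of_real (real n + 1 + x) powr (- s) :: complex) = (real n + 1 + x) powr (- Re s)"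
    using assms by (subst norm_powr_real_powr) auto
  also have "\<dots> \<le> (real n + 1 + x) powr (- \<tau>)" using assms by (intro powr_mono) auto
  also have "\<dots> \<le> (real n + 1) powr (- \<tau>)" using assms by (intro powr_mono2') auto
  finally show ?thesis .
qed

lemma summable_zeta_tail_bound: "\<tau> > 1 \<Longrightarrow> summable (\<lambda>n. (real n + 1) powr (- \<tau>))"
  using summable_real_powr_iff[of "- \<tau>"] summable_iff_shift[of "\<lambda>n. real n powr (- \<tau>)" 1] by (simp add: add.commute)

lemma zeta_tail_sums:
  assumes "x > 0" "Re s > 1"
  shows "(\<lambda>n. of_real (real n + 1 + x) powr (- s)) sums zeta_tail s x"
  unfolding zeta_tail_def
proof (rule summable_sums, rule summable_comparison_test')
  show "norm (of_real (real n + 1 + x) powr (- s) :: complex) \<le> (real n + 1) powr (- Re s)" for n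
    using assms by (intro norm_zeta_tail_term_le) auto
qed (use assms summable_zeta_tail_bound in auto)

lemma uniform_limit_zeta_tail:
  assumes "\<tau> > 1"
  shows "uniform_limit ({s. Re s \<ge> \<tau>} \<times> {0<..})
     (\<lambda>N (s,x). \<Sum>n<N. of_real (real n + 1 + x) powr (- s)) (\<lambda>(s,x). zeta_tail s x) sequentially"
  unfolding zeta_tail_def case_prod_unfold
  by (rule Weierstrass_m_test[where M = "\<lambda>n. (real n + 1) powr (- \<tau>)"])
    (use assms summable_zeta_tail_bound in \<open>auto simp del: of_real_add intro!: norm_zeta_tail_term_le\<close>)

lemma continuous_on_zeta_tail: "continuous_on ({s. Re s > 1} \<times> {0<..}) (\<lambda>(s,x). zeta_tail s x)"
proof -
  have "continuous_on (\<Union>\<tau>\<in>{1<..}. {s. Re s > \<tau>} \<times> {0<..}) (\<lambda>(s,x). zeta_tail s x)"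
  proof (rule continuous_on_open_UN)
    show "open ({s. Re s > \<tau>} \<times> {0::real<..})" for \<tau>
      by (intro open_Times open_halfspace_Re_gt open_greaterThan)
    fix \<tau> :: real assume "\<tau> \<in> {1<..}"
    have "continuous_on ({s. Re s \<ge> \<tau>} \<times> {0<..}) (\<lambda>(s,x). zeta_tail s x)"
    proof (rule uniform_limit_theorem[OF _ uniform_limit_zeta_tail])
      show "\<forall>\<^sub>F N in sequentially. continuous_on ({s. Re s \<ge> \<tau>} \<times> {0<..})
         (\<lambda>(s,x). \<Sum>n<N. complex_of_real (real n + 1 + x) powr (- s))"
        unfolding case_prod_unfold
        by (intro always_eventually allI continuous_intros) (auto simp del: of_real_add)
    qed (use \<open>\<tau> \<in> {1<..}\<close> in auto)
    then show "continuous_on ({s. Re s > \<tau>} \<times> {0<..}) (\<lambda>(s,x). zeta_tail s x)"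
      by (rule continuous_on_subset) auto
  qed
  also have "(\<Union>\<tau>\<in>{1<..}. {s. Re s > \<tau>} \<times> {0::real<..}) = {s. Re s > 1} \<times> {0<..}"
    by (auto simp: Bex_def intro: dense)
  finally show ?thesis .
qed

lemma holomorphic_on_zeta_tail:
  assumes "x > 0"
  shows "(\<lambda>s. zeta_tail s x) holomorphic_on {s. Re s > 1}"
proof (rule holomorphic_uniform_sequence)
  show "open {s. Re s > 1}" by (rule open_halfspace_Re_gt)
  show "(\<lambda>s. \<Sum>n<N. of_real (real n + 1 + x) powr (- s)) holomorphic_on {s. Re s > 1}" for N
    by (intro holomorphic_intros) (use assms in \<open>auto simp: complex_nonpos_Reals_iff\<close>)
  fix s assume s: "s \<in> {s. Re s > 1}"
  define d where "d = (Re s - 1) / 2"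
  have cb: "cball s d \<subseteq> {z. Re z \<ge> 1 + d}"
  proof
    fix z assume "z \<in> cball s d"
    then have "\<bar>Re s - Re z\<bar> \<le> d"
      using abs_Re_le_cmod[of "s - z"] by (simp add: dist_norm)
    then have "Re z \<ge> Re s - d" by linarith
    then show "z \<in> {z. Re z \<ge> 1 + d}" by (simp add: d_def field_simps)
  qed
  have "d > 0" using s by (simp add: d_def)
  have "uniform_limit (cball s d) (\<lambda>N s. \<Sum>n<N. complex_of_real (real n + 1 + x) powr (- s)) (\<lambda>s. zeta_tail s x) sequentially"
    unfolding zeta_tail_def
  proof (rule Weierstrass_m_test)
    show "norm (complex_of_real (real n + 1 + x) powr (- z)) \<le> (real n + 1) powr (- (1 + d))" if "z \<in> cball s d" for n z
      using assms that cb \<open>d > 0\<close> by (intro norm_zeta_tail_term_le) auto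
    show "summable (\<lambda>n. (real n + 1) powr (- (1 + d)))"
      using \<open>d > 0\<close> by (intro summable_zeta_tail_bound) auto
  qed
  then show "\<exists>d>0. cball s d \<subseteq> {s. Re s > 1} \<and>
      uniform_limit (cball s d) (\<lambda>N s. \<Sum>n<N. complex_of_real (real n + 1 + x) powr (- s)) (\<lambda>s. zeta_tail s x) sequentially"
    using cb \<open>d > 0\<close> by fastforce
qed

text \<open>
  The remainder of a first-order Taylor expansion in integral form, applied to the antiderivative
  \<open>y powr (1 - s) / (1 - s)\<close> of \<open>y powr (- s)\<close> on an interval of length one.
\<close>

lemma powr_taylor_integral:
  fixes y :: real and s :: complex
  assumes "y > 0" "s \<noteq> 1"
  shows "((\<lambda>u. s * ((1 - of_real u) * of_real (y + u) powr (- (s + 1)))) has_integral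
     of_real y powr (- s) - (of_real y powr (1 - s) - of_real (y + 1) powr (1 - s)) / (s - 1)) {0..1}"
proof -
  define F where "F z = - ((1 - z) * (of_real y + z) powr (- s)) - (of_real y + z) powr (1 - s) / (1 - s)" for z :: complex
  have "((\<lambda>u. s * ((1 - of_real u) * of_real (y + u) powr (- (s + 1)))) has_integral
     (F \<circ> of_real) 1 - (F \<circ> of_real) 0) {0..1}"
  proof (rule fundamental_theorem_of_calculus)
    fix u :: real assume "u \<in> {0..1}"
    then have nz: "of_real y + of_real u \<notin> (\<real>\<^sub>\<le>\<^sub>0 :: complex set)"
      using \<open>y > 0\<close> by (auto simp: complex_nonpos_Reals_iff)
    have *: "((\<lambda>z. (of_real y + z) powr p) has_field_derivative p * (of_real y + of_real u) powr (p - 1)) (at (of_real u))" for p :: complex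
      using has_field_derivative_powr[OF nz, of p] DERIV_shift[of "\<lambda>z. z powr p" _ "of_real u" "of_real y"] by (simp add: add.commute)
    have "(F has_field_derivative s * ((1 - of_real u) * of_real (y + u) powr (- (s + 1)))) (at (of_real u))"
      unfolding F_def
    proof (rule DERIV_cong)
      show "((\<lambda>z. - ((1 - z) * (of_real y + z) powr (- s)) - (of_real y + z) powr (1 - s) / (1 - s)) has_field_derivative
         - ((0 - 1) * (of_real y + of_real u) powr (- s) + (- s * (of_real y + of_real u) powr (- s - 1)) * (1 - of_real u))
         - (1 - s) * (of_real y + of_real u) powr (1 - s - 1) / (1 - s)) (at (of_real u))"
        by (rule DERIV_diff DERIV_minus DERIV_mult DERIV_cdivide DERIV_const DERIV_ident *)+
    qed (use \<open>s \<noteq> 1\<close> in \<open>simp add: mult_ac minus_diff_commute\<close>)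
    then show "(F \<circ> of_real has_vector_derivative s * ((1 - of_real u) * of_real (y + u) powr (- (s + 1)))) (at u within {0..1})"
      unfolding comp_def by (rule has_vector_derivative_real_field)
  qed auto
  also have "(F \<circ> of_real) 1 - (F \<circ> of_real) 0
    = of_real y powr (- s) - (of_real y powr (1 - s) - of_real (y + 1) powr (1 - s)) / (s - 1)"
  proof -
    have "a / (1 - s) = - (a / (s - 1))" for a
      by (metis minus_diff_eq minus_divide_right)
    then show ?thesis by (simp add: F_def diff_divide_distrib add.commute)
  qed
  finally show ?thesis .
qed

text \<open>
  Summing \<open>powr_taylor_integral\<close> over \<open>y = n + 1 + x\<close>, the boundary terms telescope.  The integral on the right
  involves only \<open>s + 1\<close>, which is what makes the identity a device for continuation.
\<close>

lemma zeta_tail_integral_recurrence: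
  assumes x: "x > 0" and s: "Re s > 1"
  shows "(s - 1) * zeta_tail s x = of_real (1 + x) powr (1 - s)
     + (s - 1) * integral {0..1} (\<lambda>u. (1 - of_real u) * (s * zeta_tail (s + 1) (x + u)))"
proof -
  have "s \<noteq> 1" using s by auto
  define a where "a n = complex_of_real (real n + 1 + x) powr (1 - s)" for n
  define f where "f N u = (\<Sum>n<N. (1 - of_real u) * (s * complex_of_real (real n + 1 + (x + u)) powr (- (s + 1))))" for N u
  have ul: "uniform_limit {0..1} f (\<lambda>u. \<Sum>n. (1 - of_real u) * (s * of_real (real n + 1 + (x + u)) powr (- (s + 1)))) sequentially"
    unfolding f_def
  proof (rule Weierstrass_m_test[where M = "\<lambda>n. norm s * (real n + 1) powr (- 2)"])
    show "norm ((1 - of_real u) * (s * complex_of_real (real n + 1 + (x + u)) powr (- (s + 1)))) \<le> norm s * (real n + 1) powr (- 2)"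
      if u: "u \<in> {0..1}" for n u
    proof -
      have "norm (complex_of_real (real n + 1 + (x + u)) powr (- (s + 1))) \<le> (real n + 1) powr (- 2)"
        using x s u by (intro norm_zeta_tail_term_le) auto
      moreover have "norm (1 - of_real u :: complex) \<le> 1"
        using u norm_of_real[of "1 - u", where 'a = complex] by simp
      ultimately have "norm (1 - of_real u :: complex) * (norm s * norm (complex_of_real (real n + 1 + (x + u)) powr (- (s + 1))))
         \<le> 1 * (norm s * (real n + 1) powr (- 2))"
        by (intro mult_mono) auto
      then show ?thesis by (simp only: norm_mult mult_1_left)
    qed
    show "summable (\<lambda>n. norm s * (real n + 1) powr (- 2))"
      by (intro summable_mult summable_zeta_tail_bound) auto
  qed
  have cont: "continuous_on {0..1} (f N)" for N
    unfolding f_def using x by (intro continuous_intros) (auto simp del: of_real_add)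
  obtain I J where I: "\<And>N. (f N has_integral I N) {0..1}"
    and J: "((\<lambda>u. \<Sum>n. (1 - of_real u) * (s * of_real (real n + 1 + (x + u)) powr (- (s + 1)))) has_integral J) {0..1}"
    and lim: "I \<longlonglongrightarrow> J"
    using uniform_limit_integral[OF ul cont] by auto
  have I_eq: "I = (\<lambda>N. (\<Sum>n<N. of_real (real n + 1 + x) powr (- s)) - (a 0 - a N) / (s - 1))"
  proof
    fix N
    have "((\<lambda>u. \<Sum>n<N. s * ((1 - of_real u) * of_real ((real n + 1 + x) + u) powr (- (s + 1)))) has_integral
       (\<Sum>n<N. of_real (real n + 1 + x) powr (- s) - (a n - a (Suc n)) / (s - 1))) {0..1}"
    proof (intro has_integral_sum)
      fix n
      show "((\<lambda>u. s * ((1 - of_real u) * of_real ((real n + 1 + x) + u) powr (- (s + 1)))) has_integral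
         of_real (real n + 1 + x) powr (- s) - (a n - a (Suc n)) / (s - 1)) {0..1}"
        using powr_taylor_integral[of "real n + 1 + x" s] x \<open>s \<noteq> 1\<close> by (simp add: a_def add_ac)
    qed auto
    also have "(\<lambda>u. \<Sum>n<N. s * ((1 - of_real u) * of_real ((real n + 1 + x) + u) powr (- (s + 1)))) = f N"
      by (auto simp: f_def fun_eq_iff mult_ac add_ac)
    finally have "I N = (\<Sum>n<N. of_real (real n + 1 + x) powr (- s) - (a n - a (Suc n)) / (s - 1))"
      by (rule has_integral_unique[OF I])
    also have "\<dots> = (\<Sum>n<N. of_real (real n + 1 + x) powr (- s)) - (a 0 - a N) / (s - 1)"
      by (subst sum_subtractf) (simp only: sum_divide_distrib[symmetric] sum_lessThan_telescope')
    finally show "I N = (\<Sum>n<N. of_real (real n + 1 + x) powr (- s)) - (a 0 - a N) / (s - 1)" .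
  qed
  have "a \<longlonglongrightarrow> 0"
  proof (rule tendsto_norm_zero_cancel)
    have "(\<lambda>n. (real n + 1 + x) powr (1 - Re s)) \<longlonglongrightarrow> 0"
      using s by real_asymp
    moreover have "norm (a n) = (real n + 1 + x) powr (1 - Re s)" for n
      unfolding a_def using x by (subst norm_powr_real_powr) auto
    ultimately show "(\<lambda>n. norm (a n)) \<longlonglongrightarrow> 0" by simp
  qed
  then have "I \<longlonglongrightarrow> zeta_tail s x - (a 0 - 0) / (s - 1)"
    using zeta_tail_sums[OF x s] \<open>s \<noteq> 1\<close> unfolding sums_def I_eq
    by (intro tendsto_intros) auto
  then have "J = zeta_tail s x - a 0 / (s - 1)"
    using lim LIMSEQ_unique by fastforce
  moreover have "integral {0..1} (\<lambda>u. (1 - of_real u) * (s * zeta_tail (s + 1) (x + u))) = J"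
  proof (rule integral_unique, rule has_integral_eq[OF _ J])
    fix u :: real assume "u \<in> {0..1}"
    then have *: "(\<lambda>n. of_real (real n + 1 + (x + u)) powr (- (s + 1))) sums zeta_tail (s + 1) (x + u)"
      using x s by (intro zeta_tail_sums) auto
    show "(\<Sum>n. (1 - of_real u) * (s * of_real (real n + 1 + (x + u)) powr (- (s + 1)))) = (1 - of_real u) * (s * zeta_tail (s + 1) (x + u))"
      by (intro sums_unique[symmetric] sums_mult *)
  qed
  ultimately show ?thesis using \<open>s \<noteq> 1\<close> by (simp add: a_def field_simps)
qed

text \<open>
  \<open>zeta_ext N s x\<close> is \<open>(s - 1) * \<zeta>(s, x + 1)\<close> continued to \<open>Re s > 1 - N\<close>.  The factor \<open>s - 1\<close> removes the pole, and
  it also absorbs the factor \<open>s\<close> of the recurrence: since \<open>s = (s + 1) - 1\<close>, the integrand is again of the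
  same form.
\<close>

fun zeta_ext :: "nat \<Rightarrow> complex \<Rightarrow> real \<Rightarrow> complex" where
  "zeta_ext 0 s x = (s - 1) * zeta_tail s x"
| "zeta_ext (Suc N) s x = of_real (1 + x) powr (1 - s)
     + (s - 1) * integral {0..1} (\<lambda>u. (1 - of_real u) * zeta_ext N (s + 1) (x + u))"

text \<open>
  Joint continuity is carried through the iteration because it makes the integrand of the next stage
  continuous in \<open>u\<close> and, by compactness, bounded locally uniformly in \<open>s\<close>.
\<close>

lemma continuous_on_zeta_ext:
  "continuous_on ({s. Re s > 1 - real N} \<times> {0<..}) (\<lambda>(s,x). zeta_ext N s x)"
proof (induction N)
  case 0
  then show ?case using continuous_on_zeta_tail
    by (auto simp: case_prod_unfold intro!: continuous_intros)
next
  case (Suc N)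
  define U where "U = {s. Re s > 1 - real (Suc N)} \<times> {0::real<..}"
  have "continuous_on (U \<times> cbox 0 1) (\<lambda>p. zeta_ext N (fst (fst p) + 1) (snd (fst p) + snd p))"
    by (rule continuous_on_compose2[OF Suc.IH, where f = "\<lambda>p. (fst (fst p) + 1, snd (fst p) + snd p)", unfolded case_prod_unfold fst_conv snd_conv])
      (auto intro!: continuous_intros simp: U_def)
  then have "continuous_on (U \<times> cbox 0 1) (\<lambda>(p, u). (1 - of_real u) * zeta_ext N (fst p + 1) (snd p + u))"
    unfolding case_prod_unfold by (intro continuous_intros)
  then have "continuous_on U (\<lambda>p. integral (cbox 0 1) (\<lambda>u. (1 - of_real u) * zeta_ext N (fst p + 1) (snd p + u)))"
    by (rule integral_continuous_on_param)
  then show ?case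
    unfolding U_def case_prod_unfold zeta_ext.simps box_real
    by (intro continuous_intros) (auto simp del: of_real_add)
qed

text \<open>
  The integral over \<open>u\<close> is holomorphic in \<open>s\<close> by \<open>has_field_derivative_set_integral\<close>, with a constant
  dominating function supplied by joint continuity.
\<close>

lemma holomorphic_on_zeta_ext:
  "x > 0 \<Longrightarrow> (\<lambda>s. zeta_ext N s x) holomorphic_on {s. Re s > 1 - real N}"
proof (induction N arbitrary: x)
  case 0
  then show ?case using holomorphic_on_zeta_tail by (auto intro!: holomorphic_intros)
next
  case (Suc N)
  let ?U = "{s. Re s > 1 - real (Suc N)}"
  define k where "k s u = (1 - of_real u) * zeta_ext N (s + 1) (x + u)" for s u
  have opU: "open ?U" by (rule open_halfspace_Re_gt)
  have cont: "continuous_on (?U \<times> {0..1}) (\<lambda>(s, u). k s u)"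
  proof -
    have "continuous_on (?U \<times> {0..1}) (\<lambda>p. zeta_ext N (fst p + 1) (x + snd p))"
      by (rule continuous_on_compose2[OF continuous_on_zeta_ext, where f = "\<lambda>p. (fst p + 1, x + snd p)", unfolded case_prod_unfold fst_conv snd_conv])
        (use Suc.prems in \<open>auto intro!: continuous_intros\<close>)
    then show ?thesis unfolding k_def case_prod_unfold by (intro continuous_intros)
  qed
  have contu: "continuous_on {0..1} (k s)" if "s \<in> ?U" for s
    by (rule continuous_on_compose2[OF cont, where f = "\<lambda>u. (s, u)", unfolded case_prod_conv])
      (use that in \<open>auto intro!: continuous_intros\<close>)
  have hol: "(\<lambda>s. k s u) holomorphic_on ?U" if "u \<in> {0..1}" for u
  proof -
    have "(\<lambda>s. zeta_ext N s (x + u)) \<circ> (\<lambda>s. s + 1) holomorphic_on ?U"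
      by (rule holomorphic_on_compose_gen[OF _ Suc.IH]) (use that Suc.prems in \<open>auto intro!: holomorphic_intros\<close>)
    then show ?thesis unfolding k_def comp_def by (intro holomorphic_intros)
  qed
  have int: "integral {0..1} (k s) = (LINT u:{0..1}|lborel. k s u)" if "s \<in> ?U" for s
    using borel_integrable_atLeastAtMost'[OF contu[OF that]] by (rule set_borel_integral_eq_integral(2)[symmetric])
  have "(\<lambda>s. LINT u:{0..1}|lborel. k s u) holomorphic_on ?U"
  proof (rule holomorphic_onI)
    fix s assume s: "s \<in> ?U"
    then obtain r where "r > 0" and r: "cball s r \<subseteq> ?U"
      using opU open_contains_cball by blast
    have "compact ((\<lambda>(s, u). k s u) ` (cball s r \<times> {0..1}))"
      by (intro compact_continuous_image continuous_on_subset[OF cont] compact_Times compact_cball compact_Icc)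
        (use r in auto)
    then obtain B where "\<forall>v\<in>(\<lambda>(s, u). k s u) ` (cball s r \<times> {0..1}). norm v \<le> B"
      using compact_imp_bounded bounded_iff by metis
    then have B: "norm (k z u) \<le> B" if "z \<in> cball s r" "u \<in> {0..1}" for z u
      using that by blast
    have "((\<lambda>s. LINT u:{0..1}|lborel. k s u) has_field_derivative (LINT u:{0..1}|lborel. deriv (\<lambda>s. k s u) s)) (at s)"
    proof (rule has_field_derivative_set_integral(2)[where U = "ball s r" and g = "\<lambda>_. B"])
      show "((\<lambda>s. k s u) has_field_derivative deriv (\<lambda>s. k s u) z) (at z)" if "z \<in> ball s r" "u \<in> {0..1}" for z u
        using hol[OF that(2)] opU by (rule holomorphic_derivI) (use that r in \<open>auto simp: subset_iff\<close>)
      show "set_borel_measurable lborel {0..1} (k z)" if "z \<in> ball s r" for z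
      proof -
        have "z \<in> ?U" using that r by (auto simp: subset_iff)
        from borel_measurable_integrable[OF borel_integrable_atLeastAtMost'[OF contu[OF this], unfolded set_integrable_def]]
        show ?thesis unfolding set_borel_measurable_def .
      qed
      show "set_integrable lborel {0..1::real} (\<lambda>_. B)"
        by (rule borel_integrable_atLeastAtMost') auto
    qed (use \<open>r > 0\<close> B in auto)
    then show "(\<lambda>s. LINT u:{0..1}|lborel. k s u) field_differentiable at s within ?U"
      using field_differentiable_at_within field_differentiable_def by blast
  qed
  then have "(\<lambda>s. integral {0..1} (k s)) holomorphic_on ?U"
    by (rule holomorphic_transform) (use int in auto)
  then show ?case
    unfolding k_def zeta_ext.simps
    by (intro holomorphic_intros) (use Suc.prems in \<open>auto simp del: of_real_add\<close>)
qed

lemma zeta_ext_eq_tail: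
  assumes "x > 0" "Re s > 1"
  shows "zeta_ext N s x = (s - 1) * zeta_tail s x"
  using assms
proof (induction N arbitrary: s x)
  case (Suc N)
  have "integral {0..1} (\<lambda>u. (1 - of_real u) * zeta_ext N (s + 1) (x + u))
      = integral {0..1} (\<lambda>u. (1 - of_real u) * (s * zeta_tail (s + 1) (x + u)))"
    by (rule Henstock_Kurzweil_Integration.integral_cong) (use Suc in auto)
  then show ?case using zeta_tail_integral_recurrence[OF Suc.prems] by simp
qed auto

lemma zeta_ext_stable:
  assumes "x > 0" "Re s > 1 - real N" "N \<le> M"
  shows "zeta_ext M s x = zeta_ext N s x"
proof (rule analytic_continuation_open[where s = "{s. Re s > 1}" and s' = "{s. Re s > 1 - real N}" and f = "\<lambda>s. zeta_ext M s x" and g = "\<lambda>s. zeta_ext N s x"])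
  show "{s. Re s > 1} \<noteq> {}" using Re_complex_of_real[of 2] by (metis (mono_tags) empty_Collect_eq one_less_numeral_iff semiring_norm(76))
  show "connected {s. Re s > 1 - real N}"
    by (intro convex_connected convex_halfspace_Re_gt)
  show "(\<lambda>s. zeta_ext M s x) holomorphic_on {s. Re s > 1 - real N}"
    using holomorphic_on_zeta_ext[OF \<open>x > 0\<close>] by (rule holomorphic_on_subset) (use assms in auto)
qed (use assms holomorphic_on_zeta_ext in \<open>auto simp: open_halfspace_Re_gt zeta_ext_eq_tail\<close>)

text \<open>
  The normalisation \<open>H 1 = 1\<close>, read off from one step of the recurrence, says that the residue at the pole is
  the same for every \<open>x\<close>; this is why the poles cancel in differences.
\<close>

lemma hurwitz_zeta_entire_numerator:
  assumes "x > 0"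
  obtains H where "H holomorphic_on UNIV" "H 1 = 1"
    "\<And>s. Re s > 1 \<Longrightarrow> (\<lambda>n. (of_nat n + of_real x) powr (- s)) sums (H s / (s - 1))"
    "\<And>s. s \<noteq> 1 \<Longrightarrow> hurwitz_zeta s (of_real x) = H s / (s - 1)"
proof -
  \<comment> \<open>A number of steps large enough to reach \<open>s\<close>; any larger number gives the same value.\<close>
  define N where "N s = nat \<lceil>2 - Re s\<rceil>" for s
  have N: "Re s > 1 - real (N s)" for s unfolding N_def by linarith
  define T where "T s = zeta_ext (N s) s x" for s
  have T: "T s = zeta_ext M s x" if "Re s > 1 - real M" for s M
    using zeta_ext_stable[OF \<open>x > 0\<close>, of "N s" s "max (N s) M"] zeta_ext_stable[OF \<open>x > 0\<close>, of M s "max (N s) M"] N that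
    by (simp add: T_def)
  define H where "H s = (s - 1) * of_real x powr (- s) + T s" for s
  have holT: "T holomorphic_on UNIV"
  proof (rule holomorphic_onI)
    fix s
    have "(\<lambda>w. zeta_ext (N s) w x) holomorphic_on {w. Re w > 1 - real (N s)}"
      using \<open>x > 0\<close> by (rule holomorphic_on_zeta_ext)
    then have "T holomorphic_on {w. Re w > 1 - real (N s)}"
      by (rule holomorphic_transform) (use T in auto)
    then show "T field_differentiable at s within UNIV"
      using N by (auto intro: holomorphic_on_imp_differentiable_at[OF _ open_halfspace_Re_gt])
  qed
  have hol: "H holomorphic_on UNIV"
    unfolding H_def by (intro holomorphic_intros holT) (use \<open>x > 0\<close> in auto)
  have H1: "H 1 = 1"
  proof -
    have "complex_of_real (1 + x) \<noteq> 0" using \<open>x > 0\<close> by (simp only: of_real_eq_0_iff)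
    then show ?thesis using T[of 1 1] by (simp add: H_def)
  qed
  have sums: "(\<lambda>n. (of_nat n + of_real x) powr (- s)) sums (H s / (s - 1))" if s: "Re s > 1" for s
  proof -
    have "(\<lambda>n. (of_nat (Suc n) + of_real x) powr (- s)) sums zeta_tail s x"
      using zeta_tail_sums[OF \<open>x > 0\<close> s] by (simp add: add_ac)
    then have "(\<lambda>n. (of_nat n + of_real x) powr (- s)) sums (zeta_tail s x + of_real x powr (- s))"
      by (subst (asm) sums_Suc_iff) simp
    also have "zeta_tail s x + of_real x powr (- s) = H s / (s - 1)"
    proof -
      have "s \<noteq> 1" "T s = (s - 1) * zeta_tail s x" using s T[of 0 s] by auto
      then show ?thesis by (simp add: H_def flip: distrib_left)
    qed
    finally show ?thesis .
  qed
  have "hurwitz_zeta s (of_real x) = H s / (s - 1)" if "s \<noteq> 1" for s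
    by (rule hurwitz_zeta_eqI[of "\<lambda>s. H s / (s - 1)"])
      (use that sums in \<open>auto intro!: holomorphic_intros holomorphic_on_subset[OF hol]\<close>)
  with hol H1 sums show ?thesis using that by blast
qed

text \<open>
  With the entire numerators \<open>H\<close> and \<open>K\<close> of the two zeta functions, \<open>(H s - K s) / (s - 1)\<close> has a removable
  singularity at \<open>1\<close> because \<open>H 1 = K 1\<close>.  The limits that define the differences at \<open>s = 1\<close> are then values of
  the continuous functions \<open>Q\<close> and \<open>deriv Q\<close>.
\<close>

lemma hurwitz_zeta_diff_entire:
  assumes "x > 0" "y > 0"
  obtains Q where "Q holomorphic_on UNIV"
    "\<And>s. Re s > 1 \<Longrightarrow> (\<lambda>n. (of_nat n + of_real x) powr (- s) - (of_nat n + of_real y) powr (- s)) sums Q s"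
    "\<And>s. hurwitz_zeta_diff 0 s (of_real x) (of_real y) = Q s"
    "\<And>s. hurwitz_zeta_diff 1 s (of_real x) (of_real y) = deriv Q s"
proof -
  obtain H where H: "H holomorphic_on UNIV" "H 1 = 1"
    "\<And>s. Re s > 1 \<Longrightarrow> (\<lambda>n. (of_nat n + of_real x) powr (- s)) sums (H s / (s - 1))"
    "\<And>s. s \<noteq> 1 \<Longrightarrow> hurwitz_zeta s (of_real x) = H s / (s - 1)"
    using hurwitz_zeta_entire_numerator[OF assms(1)] by blast
  obtain K where K: "K holomorphic_on UNIV" "K 1 = 1"
    "\<And>s. Re s > 1 \<Longrightarrow> (\<lambda>n. (of_nat n + of_real y) powr (- s)) sums (K s / (s - 1))"
    "\<And>s. s \<noteq> 1 \<Longrightarrow> hurwitz_zeta s (of_real y) = K s / (s - 1)"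
    using hurwitz_zeta_entire_numerator[OF assms(2)] by blast
  define Q where "Q s = (if s = 1 then deriv (\<lambda>s. H s - K s) 1 else (H s - K s) / (s - 1))" for s
  have hol: "Q holomorphic_on UNIV"
    by (rule pole_theorem_open_0[where g = "\<lambda>s. H s - K s" and a = 1])
      (use H K in \<open>auto intro!: holomorphic_intros simp: Q_def\<close>)
  have Q: "hurwitz_zeta s (of_real x) - hurwitz_zeta s (of_real y) = Q s" if "s \<noteq> 1" for s
    using H(4)[OF that] K(4)[OF that] that by (simp add: Q_def diff_divide_distrib)
  have dQ: "deriv (\<lambda>s. hurwitz_zeta s (of_real x)) s - deriv (\<lambda>s. hurwitz_zeta s (of_real y)) s = deriv Q s" if "s \<noteq> 1" for s
  proof -
    have dH: "(\<lambda>s. hurwitz_zeta s (of_real x)) field_differentiable at s"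
    proof (rule holomorphic_on_imp_differentiable_at)
      show "(\<lambda>s. hurwitz_zeta s (of_real x)) holomorphic_on - {1}"
        by (rule holomorphic_transform[where f = "\<lambda>s. H s / (s - 1)"])
          (use H(4) in \<open>auto intro!: holomorphic_intros holomorphic_on_subset[OF H(1)]\<close>)
    qed (use that in auto)
    have dK: "(\<lambda>s. hurwitz_zeta s (of_real y)) field_differentiable at s"
    proof (rule holomorphic_on_imp_differentiable_at)
      show "(\<lambda>s. hurwitz_zeta s (of_real y)) holomorphic_on - {1}"
        by (rule holomorphic_transform[where f = "\<lambda>s. K s / (s - 1)"])
          (use K(4) in \<open>auto intro!: holomorphic_intros holomorphic_on_subset[OF K(1)]\<close>)
    qed (use that in auto)
    have "deriv (\<lambda>s. hurwitz_zeta s (of_real x) - hurwitz_zeta s (of_real y)) s = deriv Q s"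
      by (rule deriv_cong_ev) (use Q t1_space_nhds[OF that] in \<open>auto elim!: eventually_mono\<close>)
    then show ?thesis using deriv_diff[OF dH dK] by simp
  qed
  have lim0: "Lim (at 1) (\<lambda>s. hurwitz_zeta s (of_real x) - hurwitz_zeta s (of_real y)) = Q 1"
  proof (rule tendsto_Lim)
    have "isCont Q 1" using hol by (auto intro: continuous_on_eq_continuous_at[THEN iffD1, rule_format, OF open_UNIV] holomorphic_on_imp_continuous_on)
    then show "((\<lambda>s. hurwitz_zeta s (of_real x) - hurwitz_zeta s (of_real y)) \<longlongrightarrow> Q 1) (at 1)"
      unfolding isCont_def by (rule Lim_transform_eventually) (auto simp: eventually_at_filter Q)
  qed auto
  have lim1: "Lim (at 1) (\<lambda>s. deriv (\<lambda>s. hurwitz_zeta s (of_real x)) s - deriv (\<lambda>s. hurwitz_zeta s (of_real y)) s) = deriv Q 1"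
  proof (rule tendsto_Lim)
    have "deriv Q holomorphic_on UNIV" using hol by (intro holomorphic_deriv) auto
    then have "isCont (deriv Q) 1" by (auto intro: continuous_on_eq_continuous_at[THEN iffD1, rule_format, OF open_UNIV] holomorphic_on_imp_continuous_on)
    then show "((\<lambda>s. deriv (\<lambda>s. hurwitz_zeta s (of_real x)) s - deriv (\<lambda>s. hurwitz_zeta s (of_real y)) s) \<longlongrightarrow> deriv Q 1) (at 1)"
      unfolding isCont_def by (rule Lim_transform_eventually) (auto simp: eventually_at_filter dQ)
  qed auto
  show ?thesis
  proof (rule that[OF hol])
    show "(\<lambda>n. (of_nat n + of_real x) powr (- s) - (of_nat n + of_real y) powr (- s)) sums Q s" if "Re s > 1" for s
      using sums_diff[OF H(3)[OF that] K(3)[OF that]] that by (auto simp: Q_def diff_divide_distrib)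
    show "hurwitz_zeta_diff 0 s (of_real x) (of_real y) = Q s" for s
      using Q lim0 by (simp add: hurwitz_zeta_diff_def)
    show "hurwitz_zeta_diff 1 s (of_real x) (of_real y) = deriv Q s" for s
      using dQ lim1 by (simp add: hurwitz_zeta_diff_def)
  qed
qed

text \<open>
  The terms with even and odd \<open>j\<close> are, up to the factor \<open>2 powr (- w)\<close>, the terms of the Hurwitz series at
  \<open>x / 2\<close> and \<open>(x + 1) / 2\<close>; absolute convergence permits the grouping in pairs.
\<close>

lemma hurwitz_alternating_sums:
  fixes x :: real and w :: complex
  assumes x: "x > 0" and w: "Re w > 1"
    and Q: "(\<lambda>n. (of_nat n + of_real (x / 2)) powr (- w) - (of_nat n + of_real ((x + 1) / 2)) powr (- w)) sums q"
  shows "(\<lambda>j. (- 1) ^ j * (of_nat j + of_real x) powr (- w)) sums (2 powr (- w) * q)"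
proof -
  define f where "f j = (- 1) ^ j * (of_nat j + of_real x :: complex) powr (- w)" for j
  have "summable f"
  proof (subst summable_Suc_iff[symmetric], rule summable_comparison_test')
    show "summable (\<lambda>n. (real n + 1) powr (- Re w))" using w by (rule summable_zeta_tail_bound)
    show "norm (f (Suc n)) \<le> (real n + 1) powr (- Re w)" for n
      using norm_zeta_tail_term_le[OF x order_refl, of w n] w by (simp add: f_def norm_mult norm_power add_ac)
  qed
  then have "f sums suminf f" by (rule summable_sums)
  then have "(\<lambda>n. sum f {n * 2..<n * 2 + 2}) sums suminf f" by (rule sums_group) simp
  moreover have "sum f {n * 2..<n * 2 + 2} = 2 powr (- w) *
      ((of_nat n + of_real (x / 2)) powr (- w) - (of_nat n + of_real ((x + 1) / 2)) powr (- w))" for n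
  proof -
    have pull: "(of_real (2 * y) :: complex) powr (- w) = 2 powr (- w) * of_real y powr (- w)" if "y > 0" for y
      using that by (simp add: powr_times_real)
    have "f (n * 2) = 2 powr (- w) * (of_nat n + of_real (x / 2)) powr (- w)"
      using pull[of "real n + x / 2"] x by (simp add: f_def mult.commute add_pos_nonneg)
    moreover have "f (n * 2 + 1) = - (2 powr (- w) * (of_nat n + of_real ((x + 1) / 2)) powr (- w))"
    proof -
      have e: "2 * (real n + (x + 1) / 2) = real (n * 2 + 1) + x" by (simp add: field_simps)
      have "of_nat (n * 2 + 1) + of_real x = complex_of_real (real (n * 2 + 1) + x)" by simp
      then show ?thesis using pull[of "real n + (x + 1) / 2", unfolded e] x
        by (simp only: f_def) (simp add: add_pos_pos add_nonneg_pos)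
    qed
    moreover have "{n * 2..<n * 2 + 2} = {n * 2, n * 2 + 1}" by auto
    ultimately show ?thesis by (simp add: algebra_simps)
  qed
  ultimately have "suminf f = 2 powr (- w) * q"
    using sums_mult[OF Q, of "2 powr (- w)"] sums_unique2 by fastforce
  with \<open>f sums suminf f\<close> show ?thesis by (simp add: f_def[abs_def])
qed

section \<open>The integral of a power of the hyperbolic secant\<close>

lemma sech_real_le: "sech x \<le> 2 * exp (- x)" for x :: real
  by (simp add: sech_def cosh_def divide_simps exp_minus add_pos_pos)

lemma sech_real_pos: "sech x > 0" for x :: real
  by (simp add: sech_def)

lemma has_real_derivative_sech:
  "(sech has_real_derivative - (sinh x * sech x ^ 2)) (at x)"
  unfolding sech_def[abs_def]
  by (auto intro!: derivative_eq_intros simp: power2_eq_square field_simps)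

lemma isCont_sech_real: "isCont sech (x::real)"
  using has_real_derivative_sech by (rule DERIV_isCont)

lemma set_integrable_sech_power_real:
  assumes "n \<ge> 1"
  shows "set_integrable lborel {0<..} (\<lambda>x::real. sech x ^ n)"
proof (rule set_integrable_bound)
  show "set_integrable lborel {0<..} (\<lambda>x. (2::real) ^ n * (x powr (1 - 1) * exp (- 1 * x)))"
    by (intro set_integrable_mult_right set_integrable_powr_exp) auto
  show "set_borel_measurable lborel {0<..} (\<lambda>x::real. sech x ^ n)"
    by (intro set_borel_measurable_lborel_continuous_on continuous_at_imp_continuous_on ballI continuous_power isCont_sech_real) auto
  have "sech x ^ n \<le> 2 ^ n * exp (- x)" if "x > 0" for x :: real
  proof -
    have "sech x ^ n \<le> (2 * exp (- x)) ^ n"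
      using sech_real_le sech_real_pos by (intro power_mono) (auto simp: less_imp_le)
    also have "\<dots> = 2 ^ n * exp (- x) ^ n" by (simp add: power_mult_distrib)
    also have "exp (- x) ^ n \<le> exp (- x) ^ 1"
      using assms that by (intro power_decreasing) auto
    finally show ?thesis by simp
  qed
  then show "AE x in lborel. x \<in> {0<..} \<longrightarrow> norm (sech x ^ n) \<le> norm ((2::real) ^ n * (x powr (1 - 1) * exp (- 1 * x)))"
    using sech_real_pos by (intro AE_I2) (auto simp: less_imp_le norm_mult abs_mult)
qed

lemma tendsto_sech_at_top: "((sech::real\<Rightarrow>real) \<longlongrightarrow> 0) at_top"
proof (rule tendsto_sandwich[OF always_eventually always_eventually tendsto_const])
  show "((\<lambda>x::real. 2 * exp (- x)) \<longlongrightarrow> 0) at_top" by real_asymp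
qed (use sech_real_le sech_real_pos in \<open>auto simp: less_imp_le\<close>)

lemma tanh_eq_sinh_sech: "sinh x * sech x = (tanh x :: real)"
  by (simp add: sech_def tanh_def)

lemma einterval_0_infinity: "einterval 0 \<infinity> = {0<..}"
  by (auto simp: einterval_def zero_ereal_def)

lemma LINT_greaterThan_0_FTC:
  fixes F f :: "real \<Rightarrow> real"
  assumes "\<And>x. (F has_real_derivative f x) (at x)" "\<And>x. isCont f x"
    and "set_integrable lborel {0<..} f" and lim: "(F \<longlongrightarrow> B) at_top"
  shows "(LINT x:{0<..}|lborel. f x) = B - F 0"
proof -
  have "LBINT x=0..\<infinity>. f x = B - F 0"
  proof (rule interval_integral_FTC_integrable)
    show "(F has_vector_derivative f x) (at x)" for x
      using assms(1) by (simp add: has_real_derivative_iff_has_vector_derivative)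
    have "isCont F 0" using assms(1) by (rule DERIV_isCont)
    then have "(F \<longlongrightarrow> F 0) (at_right 0)" using isCont_def tendsto_within_subset by blast
    then show "((F \<circ> real_of_ereal) \<longlongrightarrow> F 0) (at_right 0)"
      by (simp add: zero_ereal_def ereal_tendsto_simps1)
    show "((F \<circ> real_of_ereal) \<longlongrightarrow> B) (at_left \<infinity>)"
      using lim by (simp add: ereal_tendsto_simps1)
  qed (use assms in \<open>auto simp: einterval_0_infinity\<close>)
  then show ?thesis
    by (simp add: interval_lebesgue_integral_le_eq einterval_0_infinity)
qed

text \<open>
  Integrate the derivative of \<open>sinh x * sech x ^ (n + 1)\<close>, a function that vanishes at \<open>0\<close> and at infinity.
\<close>

lemma integral_sech_power_recurrence:
  assumes "n \<ge> 1"
  shows "real (n + 1) * (LINT x:{0<..}|lborel. sech x ^ (n + 2)) = real n * (LINT x:{0<..}|lborel. sech (x::real) ^ n)"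
proof -
  have "(LINT x:{0<..}|lborel. real (n + 1) * sech x ^ (n + 2) - real n * sech (x::real) ^ n) = 0 - sinh 0 * sech 0 ^ (n + 1)"
  proof (rule LINT_greaterThan_0_FTC)
    fix x :: real
    have "cosh x * sech x = 1" by (simp add: sech_def)
    then have c: "sinh x ^ 2 * sech x ^ 2 = 1 - sech x ^ 2"
      by (simp add: sinh_square_eq left_diff_distrib flip: power_mult_distrib)
    have "((\<lambda>x. sech x ^ (n + 1)) has_real_derivative real (n + 1) * (- (sinh x * sech x ^ 2) * sech x ^ n)) (at x)"
      using DERIV_power[OF has_real_derivative_sech, of "n + 1"] by simp
    moreover have "(sinh has_real_derivative cosh x) (at x)"
      by (auto intro!: derivative_eq_intros)
    ultimately have "((\<lambda>x. sinh x * sech x ^ (n + 1)) has_real_derivative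
        cosh x * sech x ^ (n + 1) + real (n + 1) * (- (sinh x * sech x ^ 2) * sech x ^ n) * sinh x) (at x)"
      by (rule DERIV_mult[rotated])
    also have "cosh x * sech x ^ (n + 1) + real (n + 1) * (- (sinh x * sech x ^ 2) * sech x ^ n) * sinh x
       = (cosh x * sech x) * sech x ^ n - real (n + 1) * sech x ^ n * (sinh x ^ 2 * sech x ^ 2)"
      by (simp add: power2_eq_square algebra_simps)
    also have "\<dots> = real (n + 1) * sech x ^ (n + 2) - real n * sech x ^ n"
      unfolding c \<open>cosh x * sech x = 1\<close> by (simp add: algebra_simps power2_eq_square)
    finally show "((\<lambda>x. sinh x * sech x ^ (n + 1)) has_real_derivative
       real (n + 1) * sech x ^ (n + 2) - real n * sech x ^ n) (at x)" .
    show "isCont (\<lambda>x. real (n + 1) * sech x ^ (n + 2) - real n * sech x ^ n) x"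
      by (intro continuous_intros isCont_sech_real)
  next
    show "set_integrable lborel {0<..} (\<lambda>x::real. real (n + 1) * sech x ^ (n + 2) - real n * sech x ^ n)"
      using assms by (intro set_integral_diff set_integrable_mult_right set_integrable_sech_power_real) auto
    have "((\<lambda>x. tanh x * sech x ^ n) \<longlongrightarrow> 1 * 0 ^ n) (at_top :: real filter)"
      by (intro tendsto_intros tendsto_sech_at_top tanh_real_at_top)
    also have "(\<lambda>x. tanh x * sech x ^ n) = (\<lambda>x::real. sinh x * sech x ^ (n + 1))"
      by (simp add: fun_eq_iff flip: tanh_eq_sinh_sech)
    finally show "((\<lambda>x. sinh x * sech x ^ (n + 1)) \<longlongrightarrow> 0) (at_top :: real filter)"
      using assms by (simp add: power_0_left)
  qed
  moreover have "(LINT x:{0<..}|lborel. real (n + 1) * sech x ^ (n + 2) - real n * sech (x::real) ^ n)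
      = (LINT x:{0<..}|lborel. real (n + 1) * sech x ^ (n + 2)) - (LINT x:{0<..}|lborel. real n * sech (x::real) ^ n)"
    using assms by (intro set_integral_diff set_integrable_mult_right set_integrable_sech_power_real) auto
  ultimately show ?thesis by (simp only: set_integral_mult_right) simp
qed

text \<open>
  The right-hand side satisfies the recurrence \<open>integral_sech_power_recurrence\<close>, by the functional equation of
  \<open>Gamma\<close>; the two initial values come from the antiderivatives \<open>arctan (sinh x)\<close> and \<open>tanh x\<close>.
\<close>

lemma integral_sech_power:
  assumes "n \<ge> 1"
  shows "(LINT x:{0<..}|lborel. sech (x::real) ^ n) = 2 powi (int n - 2) * Gamma (real n / 2) ^ 2 / fact (n - 1)"
  using assms
proof (induction n rule: less_induct)
  case (less n)
  consider "n = 1" | "n = 2" | m where "n = m + 2" "m \<ge> 1"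
    using less.prems by (metis Suc_1 add.commute add_2_eq_Suc le_SucE le_add_diff_inverse nat_le_iff_add not_less_eq_eq One_nat_def)
  then show ?case
  proof cases
    case 1
    have "(LINT x:{0<..}|lborel. sech (x::real) ^ 1) = pi / 2 - arctan (sinh 0)"
    proof (rule LINT_greaterThan_0_FTC)
      fix x :: real
      have "1 + sinh x ^ 2 = cosh x ^ 2" by (simp add: cosh_square_eq)
      then show "((\<lambda>x. arctan (sinh x)) has_real_derivative sech x ^ 1) (at x)"
        by (auto intro!: derivative_eq_intros simp: sech_def power2_eq_square field_simps)
      show "isCont (\<lambda>x. sech x ^ 1) x" by (simp add: isCont_sech_real)
    next
      show "set_integrable lborel {0<..} (\<lambda>x::real. sech x ^ 1)" by (rule set_integrable_sech_power_real) simp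
      show "((\<lambda>x. arctan (sinh x)) \<longlongrightarrow> pi / 2) at_top"
        using tendsto_arctan_at_top sinh_real_at_top by (rule filterlim_compose)
    qed
    then show ?thesis using 1 by (simp add: Gamma_one_half_real power_int_minus)
  next
    case 2
    have "(LINT x:{0<..}|lborel. sech (x::real) ^ 2) = 1 - tanh 0"
    proof (rule LINT_greaterThan_0_FTC)
      fix x :: real
      show "(tanh has_real_derivative sech x ^ 2) (at x)"
        by (auto intro!: derivative_eq_intros simp: sech_def tanh_def power2_eq_square field_simps cosh_square_eq)
          (simp add: cosh_square_eq flip: power2_eq_square)
      show "isCont (\<lambda>x. sech x ^ 2) x" by (intro continuous_intros isCont_sech_real)
    next
      show "set_integrable lborel {0<..} (\<lambda>x::real. sech x ^ 2)" by (rule set_integrable_sech_power_real) simp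
      show "(tanh \<longlongrightarrow> 1) (at_top :: real filter)" by (rule tanh_real_at_top)
    qed
    then show ?thesis using 2 by simp
  next
    case (3 m)
    have "Gamma (real n / 2) = real m / 2 * Gamma (real m / 2)"
    proof -
      have "real m / 2 \<notin> \<int>\<^sub>\<le>\<^sub>0" using 3 by (auto dest: nonpos_Ints_nonpos)
      then show ?thesis using Gamma_plus1[of "real m / 2"] 3 by (simp add: add_divide_distrib add.commute)
    qed
    moreover have "(fact (n - 1) :: real) = real (m + 1) * real m * fact (m - 1)"
      using 3 by (cases m) (auto simp: algebra_simps)
    moreover have "(2::real) powi (int n - 2) = 4 * 2 powi (int m - 2)"
      using 3 by (simp add: power_int_diff)
    moreover have "(LINT x:{0<..}|lborel. sech (x::real) ^ n) = real m / real (m + 1) * (LINT x:{0<..}|lborel. sech (x::real) ^ m)"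
      using integral_sech_power_recurrence[of m] 3 by (simp add: field_simps)
    moreover have "(LINT x:{0<..}|lborel. sech (x::real) ^ m) = 2 powi (int m - 2) * Gamma (real m / 2) ^ 2 / fact (m - 1)"
      using 3 by (intro less.IH) auto
    moreover have "real m / real (m + 1) * (T * G ^ 2 / F) = 4 * T * (real m / 2 * G) ^ 2 / (real (m + 1) * real m * F)" for T G F :: real
      using 3 by (simp add: power2_eq_square)
    ultimately show ?thesis by (simp only:)
  qed
qed

section \<open>The Mellin transform of a power of the hyperbolic secant\<close>

text \<open>
  The binomial coefficients are written as polynomials in \<open>j\<close> of degree \<open>n - 1\<close>, the form to which the
  Stirling polynomials apply.
\<close>

lemma inverse_one_plus_power_sums:
  fixes z :: complex
  assumes "n \<ge> 1" "norm z < 1"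
  shows "(\<lambda>j. (- 1) ^ j * (pochhammer (of_nat j + 1) (n - 1) / fact (n - 1)) * z ^ j) sums (1 / (1 + z) ^ n)"
proof -
  have coeff: "((- of_nat n :: complex) gchoose j) = (- 1) ^ j * (pochhammer (of_nat j + 1) (n - 1) / fact (n - 1))" for j
  proof -
    have "fact j * pochhammer (of_nat j + 1) (n - 1) = (pochhammer 1 (j + (n - 1)) :: complex)"
      by (simp add: pochhammer_product' pochhammer_fact add.commute)
    also have "\<dots> = pochhammer 1 ((n - 1) + j)" by (simp add: add.commute)
    also have "\<dots> = pochhammer 1 (n - 1) * pochhammer (1 + of_nat (n - 1)) j"
      by (rule pochhammer_product')
    also have "\<dots> = fact (n - 1) * pochhammer (of_nat n) j"
      using assms by (simp add: pochhammer_fact of_nat_diff)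
    finally show ?thesis by (simp add: gbinomial_pochhammer field_simps)
  qed
  have "1 + z \<noteq> 0" using assms by (metis add_eq_0_iff less_irrefl norm_minus_cancel norm_one)
  then have "(1 + z) powr (- of_nat n) = 1 / (1 + z) ^ n"
    by (simp add: powr_minus inverse_eq_divide)
  then show ?thesis
    using gen_binomial_complex[OF assms(2), of "- of_nat n"] by (simp add: coeff)
qed

lemma summable_inverse_one_minus_power:
  fixes r :: real
  assumes "n \<ge> 1" "0 \<le> r" "r < 1"
  shows "summable (\<lambda>j. pochhammer (real j + 1) (n - 1) / fact (n - 1) * r ^ j)"
proof -
  have "summable (\<lambda>j. (- 1) ^ j * (pochhammer (of_nat j + 1) (n - 1) / fact (n - 1)) * (- complex_of_real r) ^ j)"
    using inverse_one_plus_power_sums[of n "- of_real r"] assms by (auto simp: sums_iff)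
  also have "(\<lambda>j. (- 1) ^ j * (pochhammer (of_nat j + 1) (n - 1) / fact (n - 1)) * (- complex_of_real r) ^ j)
    = (\<lambda>j. of_real (pochhammer (real j + 1) (n - 1) / fact (n - 1) * r ^ j))"
  proof
    fix j
    have "(- 1) ^ j * (- complex_of_real r) ^ j = of_real (r ^ j)"
      by (simp flip: power_mult_distrib)
    moreover have "(pochhammer (of_nat j + 1) (n - 1) :: complex) = of_real (pochhammer (real j + 1) (n - 1))"
      by (simp add: pochhammer_of_real[symmetric])
    ultimately show "(- 1) ^ j * (pochhammer (of_nat j + 1) (n - 1) / fact (n - 1)) * (- complex_of_real r) ^ j
        = of_real (pochhammer (real j + 1) (n - 1) / fact (n - 1) * r ^ j)"
      by (simp add: mult_ac)
  qed
  finally show ?thesis by (simp only: summable_of_real_iff)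
qed

lemma cosh_ne_0_right_half_plane:
  fixes z :: complex
  assumes "Re z > 0"
  shows "cosh z \<noteq> 0"
proof
  assume "cosh z = 0"
  then have "exp z = - exp (- z)" by (simp add: cosh_def add_eq_0_iff2)
  then have "norm (exp z) = norm (exp (- z))" by (metis norm_minus_cancel)
  then show False using assms by simp
qed

lemma sech_eq_exp:
  fixes z :: complex
  shows "sech z = 2 * exp (- z) / (1 + exp (- 2 * z))"
proof -
  have "1 + exp (- 2 * z) = 2 * exp (- z) * cosh z"
    by (simp add: cosh_def scaleR_conv_of_real algebra_simps flip: exp_add)
  then show ?thesis by (simp add: sech_def)
qed

lemma continuous_on_sech_line:
  assumes "Re b > 0"
  shows "continuous_on {0..} (\<lambda>x. sech (b * of_real x) :: complex)"
  unfolding sech_def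
proof (intro continuous_intros ballI)
  fix x :: real assume "x \<in> {0..}"
  then show "cosh (b * of_real x) \<noteq> 0"
    using cosh_ne_0_right_half_plane[of "b * of_real x"] assms by (cases "x = 0") auto
qed

text \<open>
  Away from the origin \<open>1 + exp (- 2 * b * x)\<close> stays at distance \<open>1 / 2\<close> from zero; on the compact remainder
  continuity gives a bound.
\<close>

lemma norm_sech_line_le:
  assumes b: "Re b > 0"
  obtains C where "C > 0" "\<And>x. x > 0 \<Longrightarrow> norm (sech (b * of_real x) :: complex) \<le> C * exp (- Re b * x)"
proof -
  \<comment> \<open>The point beyond which \<open>norm (exp (- 2 * b * x)) \<le> 1 / 2\<close>.\<close>
  define X where "X = ln 2 / (2 * Re b)"
  have "compact ((\<lambda>x. sech (b * of_real x)) ` {0..X})"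
    by (intro compact_continuous_image continuous_on_subset[OF continuous_on_sech_line[OF b]]) auto
  then obtain B where "\<forall>v\<in>(\<lambda>x. sech (b * of_real x)) ` {0..X}. norm v \<le> B"
    using compact_imp_bounded bounded_iff by metis
  then have B: "norm (sech (b * of_real x)) \<le> B" if "x \<in> {0..X}" for x
    using that by blast
  define C where "C = max 4 (\<bar>B\<bar> * exp (Re b * X))"
  have "norm (sech (b * of_real x)) \<le> C * exp (- Re b * x)" if "x > 0" for x
  proof (cases "x \<le> X")
    case True
    have "norm (sech (b * of_real x)) \<le> \<bar>B\<bar> * 1" using B[of x] True that by auto
    also have "\<dots> \<le> \<bar>B\<bar> * exp (Re b * (X - x))" using True b by (intro mult_left_mono) auto
    also have "\<dots> = \<bar>B\<bar> * exp (Re b * X) * exp (- Re b * x)" by (simp add: algebra_simps flip: exp_add)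
    also have "\<dots> \<le> C * exp (- Re b * x)" by (intro mult_right_mono) (auto simp: C_def)
    finally show ?thesis .
  next
    case False
    have "norm (exp (- 2 * (b * of_real x))) = exp (- (2 * Re b * x))" by simp
    also have "\<dots> \<le> exp (- ln 2)" using False b by (simp add: X_def field_simps)
    finally have "norm (exp (- 2 * (b * of_real x))) \<le> 1 / 2" by (simp add: exp_minus)
    then have "norm (1 + exp (- 2 * (b * of_real x))) \<ge> 1 / 2"
      using norm_triangle_ineq2[of 1 "- exp (- 2 * (b * of_real x))"] by simp
    then have "norm (sech (b * of_real x)) \<le> 2 * exp (- Re b * x) / (1 / 2)"
      unfolding sech_eq_exp norm_divide by (intro frac_le) (auto simp: norm_mult)
    also have "\<dots> \<le> C * exp (- Re b * x)" by (simp add: C_def)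
    finally show ?thesis .
  qed
  then show ?thesis using that[of C] by (simp add: C_def)
qed

text \<open>
  Termwise integration is justified by \<open>(\<Sum>j. \<integral> norm (f j x)) < \<infinity>\<close>: the coefficients grow like \<open>j powr (n - 1)\<close> and the
  integrals decay like \<open>j powr (- Re s)\<close>, which is where \<open>Re s > n\<close> enters.
\<close>

lemma sech_power_mellin_series:
  fixes b s :: complex
  assumes n: "n \<ge> 1" and b: "Re b > 0" and s: "Re s > real n"
  shows "(\<lambda>j. 2 ^ n * ((- 1) ^ j * (pochhammer (of_nat j + 1) (n - 1) / fact (n - 1))) *
             (Gamma s * (of_nat (n + 2 * j) * b) powr (- s)))
         sums (LINT x:{0<..}|lborel. of_real x powr (s - 1) * sech (b * of_real x) ^ n)"
proof -
  define c where "c j = pochhammer (real j + 1) (n - 1) / fact (n - 1)" for j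
  define r where "r j = of_nat (n + 2 * j) * b" for j
  define f where "f j x = 2 ^ n * ((- 1) ^ j * of_real (c j)) * (of_real x powr (s - 1) * exp (- r j * of_real x))" for j x
  have c_pos: "c j > 0" for j by (simp add: c_def pochhammer_pos)
  have c_eq: "complex_of_real (c j) = pochhammer (of_nat j + 1) (n - 1) / fact (n - 1)" for j
    by (simp add: c_def pochhammer_of_real[symmetric])
  have s0: "Re s > 0" using s n by simp
  have r_pos: "Re (r j) > 0" for j using n b by (simp add: r_def)
  have int_f: "set_integrable lborel {0<..} (f j)" for j
    unfolding f_def
  proof (rule set_integrable_mult_right, rule mellin_transform(1)[where C = 1 and \<delta> = "Re (r j)"])
    show "continuous_on {0<..} (\<lambda>x. exp (- r j * complex_of_real x))" by (intro continuous_intros)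
  qed (use s0 r_pos in auto)
  have norm_f: "norm (f j x) = 2 ^ n * c j * (x powr (Re s - 1) * exp (- Re (r j) * x))" if "x > 0" for j x
    using that c_pos[of j] by (simp add: f_def norm_mult norm_power norm_powr_real_powr)
  have int_norm_f: "(LINT x:{0<..}|lborel. norm (f j x)) = 2 ^ n * c j * (Gamma (Re s) * Re (r j) powr (- Re s))" for j
  proof -
    have "complex_of_real (LINT x:{0<..}|lborel. x powr (Re s - 1) * exp (- Re (r j) * x))
        = (LINT x:{0<..}|lborel. of_real (x powr (Re s - 1) * exp (- Re (r j) * x)))"
      by (rule set_integral_complex_of_real[symmetric])
    also have "\<dots> = (LINT x:{0<..}|lborel. of_real x powr (of_real (Re s) - 1) * exp (- of_real (Re (r j)) * of_real x))"
      by (intro set_lebesgue_integral_cong) (auto simp: powr_of_real[symmetric] exp_of_real[symmetric])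
    also have "\<dots> = Gamma (of_real (Re s)) * of_real (Re (r j)) powr (- of_real (Re s))"
      using s0 r_pos by (intro Gamma_integral_complex_rate) auto
    also have "\<dots> = of_real (Gamma (Re s) * Re (r j) powr (- Re s))"
      using r_pos[of j] by (simp add: Gamma_complex_of_real powr_of_real[symmetric])
    finally have "(LINT x:{0<..}|lborel. x powr (Re s - 1) * exp (- Re (r j) * x)) = Gamma (Re s) * Re (r j) powr (- Re s)"
      using of_real_eq_iff by blast
    moreover have "(LINT x:{0<..}|lborel. norm (f j x)) = (LINT x:{0<..}|lborel. 2 ^ n * c j * (x powr (Re s - 1) * exp (- Re (r j) * x)))"
      by (intro set_lebesgue_integral_cong) (auto simp: norm_f)
    ultimately show ?thesis by simp
  qed
  have summ: "summable (\<lambda>j. LINT x:{0<..}|lborel. norm (f j x))"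
    unfolding int_norm_f
  proof (rule summable_comparison_test')
    define K where "K = 2 ^ n * Gamma (Re s) * Re b powr (- Re s)"
    have "K \<ge> 0" using s0 by (simp add: K_def Gamma_real_pos less_imp_le)
    have "summable (\<lambda>j. real (j + n) powr (real n - 1 - Re s))"
      using summable_iff_shift[of "\<lambda>j. real j powr (real n - 1 - Re s)" n] summable_real_powr_iff[of "real n - 1 - Re s"] s by simp
    then show "summable (\<lambda>j. K * real (j + n) powr (real n - 1 - Re s))" by (rule summable_mult)
    fix j :: nat
    have "c j \<le> real (j + n) ^ (n - 1)"
    proof -
      have "pochhammer (real j + 1) (n - 1) \<le> (\<Prod>i = 0..<n - 1. real (j + n))"
        unfolding pochhammer_prod by (rule prod_mono) auto
      moreover have "pochhammer (real j + 1) (n - 1) / fact (n - 1) \<le> pochhammer (real j + 1) (n - 1) / 1"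
        by (intro divide_left_mono) (auto simp: fact_ge_1 pochhammer_nonneg)
      ultimately show ?thesis by (simp add: c_def)
    qed
    also have "real (j + n) ^ (n - 1) = real (j + n) powr (real n - 1)"
      using n by (simp add: powr_realpow[symmetric] of_nat_diff)
    finally have "c j \<le> real (j + n) powr (real n - 1)" .
    moreover have "Re (r j) powr (- Re s) \<le> real (j + n) powr (- Re s) * Re b powr (- Re s)"
    proof -
      have "Re (r j) powr (- Re s) = real (n + 2 * j) powr (- Re s) * Re b powr (- Re s)"
        using b by (simp add: r_def powr_mult)
      also have "\<dots> \<le> real (j + n) powr (- Re s) * Re b powr (- Re s)"
        using s0 n by (intro mult_right_mono powr_mono2') auto
      finally show ?thesis .
    qed
    ultimately have "c j * Re (r j) powr (- Re s) \<le> real (j + n) powr (real n - 1) * (real (j + n) powr (- Re s) * Re b powr (- Re s))"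
      by (intro mult_mono) auto
    also have "\<dots> = Re b powr (- Re s) * real (j + n) powr (real n - 1 - Re s)"
      by (simp add: mult_ac flip: powr_add)
    finally have "2 ^ n * Gamma (Re s) * (c j * Re (r j) powr (- Re s)) \<le> 2 ^ n * Gamma (Re s) * (Re b powr (- Re s) * real (j + n) powr (real n - 1 - Re s))"
      using s0 by (intro mult_left_mono) (auto simp: Gamma_real_pos less_imp_le)
    moreover have "norm (2 ^ n * c j * (Gamma (Re s) * Re (r j) powr (- Re s))) = 2 ^ n * Gamma (Re s) * (c j * Re (r j) powr (- Re s))"
      using s0 less_imp_le[OF c_pos[of j]] less_imp_le[OF Gamma_real_pos[OF s0]]
      by (simp only: real_norm_def abs_mult abs_of_nonneg powr_ge_zero zero_le_power zero_le_numeral mult_ac)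
    ultimately show "norm (2 ^ n * c j * (Gamma (Re s) * Re (r j) powr (- Re s))) \<le> K * real (j + n) powr (real n - 1 - Re s)"
      by (simp add: K_def mult_ac)
  qed
  have pointwise: "summable (\<lambda>j. norm (f j x))" "(\<Sum>j. f j x) = of_real x powr (s - 1) * sech (b * of_real x) ^ n" if "x > 0" for x
  proof -
    define z where "z = exp (- 2 * (b * of_real x))"
    have z: "norm z < 1" using b that by (simp add: z_def)
    have ex: "exp (- r j * of_real x) = exp (- (b * of_real x)) ^ n * z ^ j" for j
    proof -
      have "- r j * of_real x = of_nat n * (- (b * of_real x)) + of_nat j * (- 2 * (b * of_real x))"
        by (simp add: r_def algebra_simps)
      then show ?thesis by (simp only: exp_add exp_of_nat_mult z_def)
    qed
    have f: "f j x = 2 ^ n * of_real x powr (s - 1) * exp (- (b * of_real x)) ^ n * ((- 1) ^ j * of_real (c j) * z ^ j)" for j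
      unfolding f_def ex by (simp only: mult_ac)
    have "summable (\<lambda>j. norm (2 ^ n * of_real x powr (s - 1) * exp (- (b * of_real x)) ^ n :: complex) * (c j * norm z ^ j))"
      unfolding c_def by (intro summable_mult summable_inverse_one_minus_power) (use n z in auto)
    then show "summable (\<lambda>j. norm (f j x))"
      using c_pos by (simp add: f norm_mult norm_power abs_of_pos mult_ac)
    have "(\<lambda>j. f j x) sums (2 ^ n * of_real x powr (s - 1) * exp (- (b * of_real x)) ^ n * (1 / (1 + z) ^ n))"
      unfolding f c_eq by (intro sums_mult inverse_one_plus_power_sums n z)
    also have "2 ^ n * of_real x powr (s - 1) * exp (- (b * of_real x)) ^ n * (1 / (1 + z) ^ n)
       = of_real x powr (s - 1) * sech (b * of_real x) ^ n"
      by (simp add: sech_eq_exp z_def power_divide power_mult_distrib)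
    finally show "(\<Sum>j. f j x) = of_real x powr (s - 1) * sech (b * of_real x) ^ n"
      by (simp add: sums_iff)
  qed
  have "(\<lambda>j. LINT x|lborel. indicator {0<..} x *\<^sub>R f j x) sums (LINT x|lborel. (\<Sum>j. indicator {0<..} x *\<^sub>R f j x))"
  proof (rule sums_integral)
    show "integrable lborel (\<lambda>x. indicator {0<..} x *\<^sub>R f j x)" for j
      using int_f[of j] by (simp add: set_integrable_def)
    show "AE x in lborel. summable (\<lambda>j. norm (indicator {0<..} x *\<^sub>R f j x))"
      using pointwise(1) by (intro AE_I2) (auto simp: indicator_def)
    show "summable (\<lambda>j. LINT x|lborel. norm (indicator {0<..} x *\<^sub>R f j x))"
      using summ by (simp add: set_lebesgue_integral_def)
  qed
  moreover have "(LINT x|lborel. (\<Sum>j. indicator {0<..} x *\<^sub>R f j x)) = (LINT x:{0<..}|lborel. of_real x powr (s - 1) * sech (b * of_real x) ^ n)"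
    unfolding set_lebesgue_integral_def
    by (intro Bochner_Integration.integral_cong) (auto simp: indicator_def pointwise(2))
  moreover have "(LINT x|lborel. indicator {0<..} x *\<^sub>R f j x) = 2 ^ n * ((- 1) ^ j * of_real (c j)) * (Gamma s * r j powr (- s))" for j
    using Gamma_integral_complex_rate[OF s0 r_pos, of j]
    unfolding set_lebesgue_integral_def[symmetric] f_def by simp
  ultimately show ?thesis
    by (simp add: c_eq r_def)
qed

text \<open>
  With \<open>Q w = \<zeta>(w, n / 4) - \<zeta>(w, (n + 2) / 4)\<close>, this is the Mellin transform of \<open>sech x ^ n\<close>.  The exponent of
  \<open>2\<close> is \<open>- (s + w)\<close> for \<open>w = s + k + 1 - n\<close>: one part comes from \<open>n + 2 * j = 2 * (j + n / 2)\<close>, the other from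
  \<open>hurwitz_alternating_sums\<close>.
\<close>

definition sech_mellin :: "nat \<Rightarrow> (complex \<Rightarrow> complex) \<Rightarrow> complex \<Rightarrow> complex" where
  "sech_mellin n Q s = 2 ^ n / fact (n - 1) * Gamma s *
     (\<Sum>k=0..n - 1. (- 1) ^ k * stirling_poly k (n - 1) (of_nat n / 2) *
        (2 powr (- (2 * s + (of_nat (k + 1) - of_nat n))) * Q (s + (of_nat (k + 1) - of_nat n))))"

text \<open>
  In each term of \<open>sech_power_mellin_series\<close> the coefficient is expanded in powers of \<open>y = j + n / 2\<close>; together
  with \<open>y powr (- s)\<close> the power \<open>y ^ (n - 1 - k)\<close> becomes \<open>y powr (- w)\<close> with \<open>w = s + k + 1 - n\<close>.  Since
  \<open>Re w > 1\<close>, the \<open>n\<close> alternating series converge separately.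
\<close>

lemma sech_power_mellin_large:
  assumes n: "n \<ge> 1" and b: "Re b > 0" and s: "Re s > real n"
    and Q: "\<And>w. Re w > 1 \<Longrightarrow> (\<lambda>j. (of_nat j + of_real (real n / 4)) powr (- w) - (of_nat j + of_real (real (n + 2) / 4)) powr (- w)) sums Q w"
  shows "(LINT x:{0<..}|lborel. of_real x powr (s - 1) * sech (b * of_real x) ^ n)
     = b powr (- s) * sech_mellin n Q s"
proof -
  define P where "P k = stirling_poly k (n - 1) (of_nat n / 2)" for k
  define w where "w k = s + (of_nat (k + 1) - of_nat n)" for k
  define y where "y j = (of_nat j + of_real (real n / 2) :: complex)" for j
  define C where "C = 2 ^ n / fact (n - 1) * Gamma s * 2 powr (- s) * b powr (- s)"
  have y: "y j = of_real (real j + real n / 2)" "y j \<noteq> 0" for j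
  proof -
    show *: "y j = of_real (real j + real n / 2)" by (simp add: y_def)
    have "real j + real n / 2 \<noteq> 0" using n by (simp add: add_nonneg_eq_0_iff)
    then show "y j \<noteq> 0" unfolding * of_real_eq_0_iff .
  qed
  have alt: "(\<lambda>j. (- 1) ^ j * y j powr (- w k)) sums (2 powr (- w k) * Q (w k))" for k
    unfolding y_def
  proof (rule hurwitz_alternating_sums)
    show "Re (w k) > 1" using s by (simp add: w_def)
    from Q[OF this] show "(\<lambda>j. (of_nat j + of_real (real n / 2 / 2)) powr (- w k) - (of_nat j + of_real ((real n / 2 + 1) / 2)) powr (- w k)) sums Q (w k)"
      by (simp add: add_divide_distrib add.commute add.left_commute)
  qed (use n in auto)
  have summand: "2 ^ n * ((- 1) ^ j * (pochhammer (of_nat j + 1) (n - 1) / fact (n - 1))) * (Gamma s * (of_nat (n + 2 * j) * b) powr (- s))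
     = C * (\<Sum>k=0..n - 1. (- 1) ^ k * P k * ((- 1) ^ j * y j powr (- w k)))" for j
  proof -
    have "(of_nat (n + 2 * j) * b) powr (- s) = of_nat (n + 2 * j) powr (- s) * b powr (- s)"
      by (rule powr_times_real_left) auto
    also have "of_nat (n + 2 * j) powr (- s) = 2 powr (- s) * y j powr (- s)"
    proof -
      have "(of_nat (n + 2 * j) :: complex) = 2 * y j" by (simp add: y_def)
      also have "(2 * y j) powr (- s) = 2 powr (- s) * y j powr (- s)"
        unfolding y by (rule powr_times_real_left) auto
      finally show ?thesis .
    qed
    finally have p: "(of_nat (n + 2 * j) * b) powr (- s) = 2 powr (- s) * y j powr (- s) * b powr (- s)" .
    have e: "y j powr (- s) * y j ^ (n - 1 - k) = y j powr (- w k)" if "k \<in> {0..n - 1}" for k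
    proof -
      have "y j powr (- s) * y j ^ (n - 1 - k) = y j powr (- s) * y j powr (of_nat (n - 1 - k))"
        using y by simp
      also have "\<dots> = y j powr (- s + of_nat (n - 1 - k))" by (simp only: powr_add)
      also have "- s + of_nat (n - 1 - k) = - w k"
        using that n by (simp add: w_def of_nat_diff)
      finally show ?thesis .
    qed
    have "y j powr (- s) * pochhammer (of_nat j + 1) (n - 1) = (\<Sum>k=0..n - 1. (- 1) ^ k * P k * (y j powr (- s) * y j ^ (n - 1 - k)))"
      by (subst stirling_poly_identity[where x = "of_nat n / 2"]) (simp add: sum_distrib_left P_def y_def mult_ac)
    also have "\<dots> = (\<Sum>k=0..n - 1. (- 1) ^ k * P k * y j powr (- w k))"
      by (intro sum.cong refl) (simp only: e)
    finally have q: "y j powr (- s) * pochhammer (of_nat j + 1) (n - 1) = (\<Sum>k=0..n - 1. (- 1) ^ k * P k * y j powr (- w k))" .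
    have "2 ^ n * ((- 1) ^ j * (pochhammer (of_nat j + 1) (n - 1) / fact (n - 1))) * (Gamma s * (of_nat (n + 2 * j) * b) powr (- s))
       = C * ((- 1) ^ j * (y j powr (- s) * pochhammer (of_nat j + 1) (n - 1)))"
      unfolding p C_def by (simp only: divide_inverse mult_ac)
    also have "\<dots> = C * (\<Sum>k=0..n - 1. (- 1) ^ k * P k * ((- 1) ^ j * y j powr (- w k)))"
      unfolding q by (simp add: sum_distrib_left mult_ac)
    finally show ?thesis .
  qed
  have "(\<lambda>j. C * (\<Sum>k=0..n - 1. (- 1) ^ k * P k * ((- 1) ^ j * y j powr (- w k)))) sums
      (C * (\<Sum>k=0..n - 1. (- 1) ^ k * P k * (2 powr (- w k) * Q (w k))))"
    by (intro sums_mult sums_sum alt)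
  moreover have "(\<lambda>j. C * (\<Sum>k=0..n - 1. (- 1) ^ k * P k * ((- 1) ^ j * y j powr (- w k)))) sums
      (LINT x:{0<..}|lborel. of_real x powr (s - 1) * sech (b * of_real x) ^ n)"
    using sech_power_mellin_series[OF n b s] unfolding summand .
  ultimately have "(LINT x:{0<..}|lborel. of_real x powr (s - 1) * sech (b * of_real x) ^ n)
     = C * (\<Sum>k=0..n - 1. (- 1) ^ k * P k * (2 powr (- w k) * Q (w k)))"
    using sums_unique2 by blast
  also have "\<dots> = b powr (- s) * (2 ^ n / fact (n - 1) * Gamma s * (2 powr (- s) * (\<Sum>k=0..n - 1. (- 1) ^ k * P k * (2 powr (- w k) * Q (w k)))))"
    unfolding C_def by (simp only: mult_ac)
  also have "2 powr (- s) * (\<Sum>k=0..n - 1. (- 1) ^ k * P k * (2 powr (- w k) * Q (w k)))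
     = (\<Sum>k=0..n - 1. (- 1) ^ k * P k * (2 powr (- (2 * s + (of_nat (k + 1) - of_nat n))) * Q (w k)))"
  proof -
    have "2 powr (- (2 * s + (of_nat (k + 1) - of_nat n))) = 2 powr (- s) * 2 powr (- w k)" for k
      by (simp add: w_def algebra_simps flip: powr_add)
    then show ?thesis by (simp add: sum_distrib_left mult_ac)
  qed
  finally show ?thesis unfolding sech_mellin_def P_def w_def by simp
qed

lemma holomorphic_on_sech_mellin:
  assumes "Q holomorphic_on UNIV"
  shows "sech_mellin n Q holomorphic_on {s. Re s > 0}"
proof -
  have "(\<lambda>s. Q (s + c)) holomorphic_on {s. Re s > 0}" for c
  proof -
    have "Q \<circ> (\<lambda>s. s + c) holomorphic_on {s. Re s > 0}"
      by (rule holomorphic_on_compose_gen[OF _ assms]) (auto intro!: holomorphic_intros)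
    then show ?thesis by (simp add: comp_def)
  qed
  then show ?thesis
    unfolding sech_mellin_def[abs_def] by (intro holomorphic_intros) (auto elim!: nonpos_Ints_cases)
qed

text \<open>
  Both sides of the second claim are holomorphic on the right half-plane and agree for \<open>Re s > n\<close>.
\<close>

lemma sech_power_mellin:
  assumes n: "n \<ge> 1" and b: "Re b > 0"
    and holQ: "Q holomorphic_on UNIV"
    and Q: "\<And>w. Re w > 1 \<Longrightarrow> (\<lambda>j. (of_nat j + of_real (real n / 4)) powr (- w) - (of_nat j + of_real (real (n + 2) / 4)) powr (- w)) sums Q w"
    and s: "Re s > 0"
  shows "set_integrable lborel {0<..} (\<lambda>x. of_real x powr (s - 1) * sech (b * of_real x) ^ n)"
    and "(LINT x:{0<..}|lborel. of_real x powr (s - 1) * sech (b * of_real x) ^ n)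
     = b powr (- s) * sech_mellin n Q s"
    and "set_integrable lborel {0<..} (\<lambda>x. of_real (ln x) * (of_real x powr (s - 1) * sech (b * of_real x) ^ n))"
    and "((\<lambda>s. LINT x:{0<..}|lborel. of_real x powr (s - 1) * sech (b * of_real x) ^ n) has_field_derivative
        (LINT x:{0<..}|lborel. of_real (ln x) * (of_real x powr (s - 1) * sech (b * of_real x) ^ n))) (at s)"
proof -
  obtain C where C: "C > 0" "\<And>x. x > 0 \<Longrightarrow> norm (sech (b * of_real x)) \<le> C * exp (- Re b * x)"
    using norm_sech_line_le[OF b] by blast
  have cont: "continuous_on {0<..} (\<lambda>x. sech (b * of_real x) ^ n)"
    by (intro continuous_on_power continuous_on_subset[OF continuous_on_sech_line[OF b]]) auto
  have bound: "norm (sech (b * of_real x) ^ n) \<le> C ^ n * exp (- (real n * Re b) * x)" if "x > 0" for x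
  proof -
    have "norm (sech (b * of_real x) ^ n) \<le> (C * exp (- Re b * x)) ^ n"
      unfolding norm_power using C(2)[OF that] by (intro power_mono) auto
    also have "\<dots> = C ^ n * exp (- (real n * Re b) * x)"
      by (simp add: power_mult_distrib mult_ac flip: exp_of_nat_mult)
    finally show ?thesis .
  qed
  have "real n * Re b > 0" using n b by simp
  note mellin = mellin_transform[OF cont bound this]
  show "set_integrable lborel {0<..} (\<lambda>x. of_real x powr (s - 1) * sech (b * of_real x) ^ n)"
    and "set_integrable lborel {0<..} (\<lambda>x. of_real (ln x) * (of_real x powr (s - 1) * sech (b * of_real x) ^ n))"
    and "((\<lambda>s. LINT x:{0<..}|lborel. of_real x powr (s - 1) * sech (b * of_real x) ^ n) has_field_derivative
        (LINT x:{0<..}|lborel. of_real (ln x) * (of_real x powr (s - 1) * sech (b * of_real x) ^ n))) (at s)"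
    using mellin s by blast+
  show "(LINT x:{0<..}|lborel. of_real x powr (s - 1) * sech (b * of_real x) ^ n)
     = b powr (- s) * sech_mellin n Q s"
  proof (rule analytic_continuation_open[where s = "{s. Re s > real n}" and s' = "{s. Re s > 0}"
        and f = "\<lambda>s. LINT x:{0<..}|lborel. of_real x powr (s - 1) * sech (b * of_real x) ^ n"
        and g = "\<lambda>s. b powr (- s) * sech_mellin n Q s"])
    have "of_nat (n + 1) \<in> {s. Re s > real n}" by simp
    then show "{s. Re s > real n} \<noteq> {}" by blast
    show "connected {s. Re s > 0}" by (intro convex_connected convex_halfspace_Re_gt)
    show "(\<lambda>s. LINT x:{0<..}|lborel. of_real x powr (s - 1) * sech (b * of_real x) ^ n) holomorphic_on {s. Re s > 0}"
    proof (rule holomorphic_onI)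
      fix z :: complex assume "z \<in> {s. Re s > 0}"
      then show "(\<lambda>s. LINT x:{0<..}|lborel. of_real x powr (s - 1) * sech (b * of_real x) ^ n) field_differentiable at z within {s. Re s > 0}"
        using mellin(3) field_differentiable_at_within field_differentiable_def by blast
    qed
    show "(\<lambda>s. b powr (- s) * sech_mellin n Q s) holomorphic_on {s. Re s > 0}"
      by (intro holomorphic_intros holomorphic_on_sech_mellin[OF holQ])
    show "(LINT x:{0<..}|lborel. of_real x powr (z - 1) * sech (b * of_real x) ^ n) = b powr (- z) * sech_mellin n Q z"
      if "z \<in> {s. Re s > real n}" for z
      by (rule sech_power_mellin_large[OF n b _ Q]) (use that in auto)
  qed (use s n in \<open>auto simp: open_halfspace_Re_gt\<close>)
qed

text \<open>
  The constants \<open>\<gamma>\<close> and \<open>ln 4\<close> arise as the logarithmic derivatives of \<open>Gamma s\<close> and of \<open>2 powr (- 2 * s)\<close> at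
  \<open>s = 1\<close>.  The index \<open>k\<close> of the Stirling polynomials is shifted by two.
\<close>

lemma sech_mellin_deriv_1:
  assumes n: "n \<ge> 1" and holQ: "Q holomorphic_on UNIV"
  shows "(sech_mellin n Q has_field_derivative
     2 ^ (2 * n - 1) / fact (n - 1) * (\<Sum>k = 2..n + 1. (- 1 / 2) ^ k * stirling_poly (k - 2) (n - 1) (of_nat n / 2) *
        (deriv Q (of_nat k - of_nat n) - (euler_mascheroni + ln 4) * Q (of_nat k - of_nat n)))) (at 1)"
proof -
  define P where "P k = stirling_poly k (n - 1) (of_nat n / 2)" for k
  define d where "d k = (of_nat (k + 1) - of_nat n :: complex)" for k
  define e where "e k = (2 :: complex) powr (- (2 + d k))" for k
  have dQ: "(Q has_field_derivative deriv Q z) (at z)" for z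
    using holQ by (intro holomorphic_derivI[of _ UNIV]) auto
  have t: "((\<lambda>s. (- 1) ^ k * P k * (2 powr (- (2 * s + d k)) * Q (s + d k))) has_field_derivative
      (- 1) ^ k * P k * (e k * (deriv Q (1 + d k) - 2 * ln 2 * Q (1 + d k)))) (at 1)" for k
  proof -
    have "((\<lambda>s. Q (s + d k)) has_field_derivative deriv Q (1 + d k)) (at 1)"
      using dQ[of "1 + d k"] by (simp add: DERIV_shift)
    moreover have "((\<lambda>s. 2 powr (- (2 * s + d k))) has_field_derivative - 2 * ln 2 * e k) (at 1)"
      unfolding e_def powr_def by (auto intro!: derivative_eq_intros)
    ultimately show ?thesis
      by (auto intro!: derivative_eq_intros simp: e_def algebra_simps)
  qed
  have G: "(Gamma has_field_derivative - euler_mascheroni) (at (1::complex))"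
    using has_field_derivative_Gamma[of "1::complex" UNIV] by simp
  define D where "D = 2 ^ n / fact (n - 1) * (\<Sum>k=0..n - 1. (- 1) ^ k * P k * (e k *
     (deriv Q (1 + d k) - (euler_mascheroni + ln 4) * Q (1 + d k))))"
  have ln4: "ln 4 = 2 * ln (2 :: complex)"
  proof -
    have "ln (complex_of_real 4) = of_real (2 * ln 2)"
      using ln_realpow[of 2 2] by (subst Ln_of_real) auto
    moreover have "ln (complex_of_real 2) = of_real (ln 2)" by (rule Ln_of_real) auto
    ultimately show ?thesis by simp
  qed
  have "(sech_mellin n Q has_field_derivative D) (at 1)"
  proof -
    have "((\<lambda>s. \<Sum>k=0..n - 1. (- 1) ^ k * P k * (2 powr (- (2 * s + d k)) * Q (s + d k))) has_field_derivative
       (\<Sum>k=0..n - 1. (- 1) ^ k * P k * (e k * (deriv Q (1 + d k) - 2 * ln 2 * Q (1 + d k))))) (at 1)"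
      by (intro DERIV_sum t)
    moreover have "D = 2 ^ n / fact (n - 1) * ((\<Sum>k=0..n - 1. (- 1) ^ k * P k * (e k * (deriv Q (1 + d k) - 2 * ln 2 * Q (1 + d k))))
        - euler_mascheroni * (\<Sum>k=0..n - 1. (- 1) ^ k * P k * (2 powr (- (2 * 1 + d k)) * Q (1 + d k))))"
      unfolding D_def ln4 e_def mult_1_right
      by (simp add: sum_distrib_left algebra_simps sum.distrib sum_subtractf)
    moreover note DERIV_mult[OF DERIV_cmult[OF G, of "2 ^ n / fact (n - 1)"] calculation(1)]
    ultimately show ?thesis
      unfolding sech_mellin_def[abs_def] P_def[symmetric] d_def[symmetric]
      by (elim DERIV_cong) (simp add: algebra_simps)
  qed
  also have "D = 2 ^ (2 * n - 1) / fact (n - 1) * (\<Sum>k = 2..n + 1. (- 1 / 2) ^ k * P (k - 2) *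
        (deriv Q (of_nat k - of_nat n) - (euler_mascheroni + ln 4) * Q (of_nat k - of_nat n)))"
  proof -
    have e: "2 ^ n * e k = 2 ^ (2 * n - 1) / 2 ^ (k + 2)" for k
    proof -
      have "2 ^ n * e k = 2 powr (of_nat n + - (2 + d k))"
        unfolding e_def by (simp only: powr_add powr_nat) simp
      also have "of_nat n + - (2 + d k) = of_nat (2 * n - 1) - of_nat (k + 2)"
        using n by (simp add: d_def of_nat_diff)
      also have "2 powr (of_nat (2 * n - 1) - of_nat (k + 2)) = (2::complex) ^ (2 * n - 1) / 2 ^ (k + 2)"
        by (simp only: powr_diff powr_nat) simp
      finally show ?thesis .
    qed
    have "D = (\<Sum>k=0..n - 1. (2 ^ n * e k) / fact (n - 1) * ((- 1) ^ k * P k *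
     (deriv Q (1 + d k) - (euler_mascheroni + ln 4) * Q (1 + d k))))"
      unfolding D_def sum_distrib_left by (intro sum.cong refl) (simp add: mult_ac)
    also have "\<dots> = (\<Sum>k=0..n - 1. 2 ^ (2 * n - 1) / fact (n - 1) * ((- 1 / 2) ^ (k + 2) * P (k + 2 - 2) *
        (deriv Q (of_nat (k + 2) - of_nat n) - (euler_mascheroni + ln 4) * Q (of_nat (k + 2) - of_nat n))))"
    proof (intro sum.cong refl)
      fix k
      have "(- 1 / 2) ^ (k + 2) = (- 1) ^ k / (2 :: complex) ^ (k + 2)" by (simp only: power_divide) simp
      moreover have "1 + d k = of_nat (k + 2) - of_nat n" by (simp add: d_def)
      ultimately show "(2 ^ n * e k) / fact (n - 1) * ((- 1) ^ k * P k *
          (deriv Q (1 + d k) - (euler_mascheroni + ln 4) * Q (1 + d k)))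
        = 2 ^ (2 * n - 1) / fact (n - 1) * ((- 1 / 2) ^ (k + 2) * P (k + 2 - 2) *
          (deriv Q (of_nat (k + 2) - of_nat n) - (euler_mascheroni + ln 4) * Q (of_nat (k + 2) - of_nat n)))"
        unfolding e by (simp only: divide_inverse mult_ac diff_add_inverse2)
    qed
    also have "\<dots> = (\<Sum>k=0+2..n - 1+2. 2 ^ (2 * n - 1) / fact (n - 1) * ((- 1 / 2) ^ k * P (k - 2) *
        (deriv Q (of_nat k - of_nat n) - (euler_mascheroni + ln 4) * Q (of_nat k - of_nat n))))"
      by (rule sum.shift_bounds_cl_nat_ivl[symmetric])
    also have "{0 + 2..n - 1 + 2} = {2..n + 1}" using n by auto
    finally show ?thesis by (simp only: sum_distrib_left)
  qed
  finally show ?thesis unfolding P_def .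
qed

theorem theorem1:
  fixes n :: nat and a :: real and b :: complex
  assumes "n \<ge> 1" and "a > 0" and "Re b > 0"
  shows "set_integrable lborel {0<..}
           (\<lambda>x. of_real (ln (a * x)) * sech (b * of_real x) ^ n) \<and>
         (LINT x:{0<..}|lborel. of_real (ln (a * x)) * sech (b * of_real x) ^ n) =
           2 powi (int n - 2) * Gamma (of_nat n / 2) ^ 2 * ln (of_real a / b) / (b * fact (n - 1))
         + 2 ^ (2 * n - 1) / (b * fact (n - 1)) *
             (\<Sum>k = 2..n + 1. (- 1 / 2) ^ k * stirling_poly (k - 2) (n - 1) (of_nat n / 2) *
                (hurwitz_zeta_diff 1 (of_nat k - of_nat n) (of_nat n / 4) (of_nat (n + 2) / 4)
                 - (euler_mascheroni + ln 4) *
                   hurwitz_zeta_diff 0 (of_nat k - of_nat n) (of_nat n / 4) (of_nat (n + 2) / 4)))"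
proof -
  have "real n / 4 > 0" "real (n + 2) / 4 > 0" using assms(1) by auto
  from hurwitz_zeta_diff_entire[OF this] obtain Q where holQ: "Q holomorphic_on UNIV"
    and Q: "\<And>s. Re s > 1 \<Longrightarrow> (\<lambda>j. (of_nat j + of_real (real n / 4)) powr (- s) - (of_nat j + of_real (real (n + 2) / 4)) powr (- s)) sums Q s"
    and Q0: "\<And>s. hurwitz_zeta_diff 0 s (of_real (real n / 4)) (of_real (real (n + 2) / 4)) = Q s"
    and Q1: "\<And>s. hurwitz_zeta_diff 1 s (of_real (real n / 4)) (of_real (real (n + 2) / 4)) = deriv Q s"
    by blast
  define N where "N = sech_mellin n Q"
  define N' where "N' = 2 ^ (2 * n - 1) / fact (n - 1) * (\<Sum>k = 2..n + 1. (- 1 / 2) ^ k * stirling_poly (k - 2) (n - 1) (of_nat n / 2) *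
        (deriv Q (of_nat k - of_nat n) - (euler_mascheroni + ln 4) * Q (of_nat k - of_nat n)))"
  define I where "I c = (LINT x:{0<..}|lborel. sech (c * of_real x) ^ n)" for c :: complex
  define L where "L = (LINT x:{0<..}|lborel. of_real (ln x) * sech (b * of_real x) ^ n)"
  have b: "b \<noteq> 0" "b \<notin> \<real>\<^sub>\<le>\<^sub>0" using assms(3) by (auto simp: complex_nonpos_Reals_iff)
  note mellin = sech_power_mellin[OF assms(1) _ holQ Q, where s = 1]
  \<comment> \<open>At \<open>s = 1\<close> the kernel is \<open>x powr 0\<close>, which is \<open>1\<close> on the positive axis.\<close>
  have cong: "set_integrable lborel {0<..} (\<lambda>x. g x * (of_real x powr (1 - 1) * f x)) = set_integrable lborel {0<..} (\<lambda>x. g x * f x)"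
    "(LINT x:{0<..}|lborel. g x * (of_real x powr (1 - 1) * f x)) = (LINT x:{0<..}|lborel. g x * f x)"
    "set_integrable lborel {0<..} (\<lambda>x. of_real x powr (1 - 1) * f x) = set_integrable lborel {0<..} f"
    "(LINT x:{0<..}|lborel. of_real x powr (1 - 1) * f x) = (LINT x:{0<..}|lborel. f x)"
    for f g :: "real \<Rightarrow> complex"
    by (intro set_integrable_cong set_lebesgue_integral_cong; simp)+
  have int: "set_integrable lborel {0<..} (\<lambda>x. sech (b * of_real x) ^ n)"
    using mellin(1)[OF assms(3)] unfolding cong by simp
  have intln: "set_integrable lborel {0<..} (\<lambda>x. of_real (ln x) * sech (b * of_real x) ^ n)"
    using mellin(3)[OF assms(3)] unfolding cong by simp
  have I: "I c = N 1 / c" if "Re c > 0" for c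
    using mellin(2)[OF that] that unfolding cong by (auto simp: I_def N_def powr_minus divide_inverse)
  have N1: "N 1 = 2 powi (int n - 2) * Gamma (of_nat n / 2) ^ 2 / fact (n - 1)"
  proof -
    have sech_of_real: "sech (of_real x) = (of_real (sech x) :: complex)" for x
      by (simp add: sech_def cosh_def scaleR_conv_of_real exp_minus exp_of_real)
    have "I 1 = of_real (LINT x:{0<..}|lborel. sech x ^ n)"
      unfolding I_def by (simp add: sech_of_real flip: set_integral_complex_of_real of_real_power)
    also have "\<dots> = 2 powi (int n - 2) * Gamma (of_nat n / 2) ^ 2 / fact (n - 1)"
      using integral_sech_power[OF assms(1)] by (simp add: Gamma_complex_of_real[symmetric])
    finally show ?thesis using I[of 1] by simp
  qed
  \<comment> \<open>\<open>L\<close> is the derivative at \<open>1\<close> of the transform, computed from the product \<open>b powr (- s) * N s\<close>.\<close>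
  have L: "L = (N' - ln b * N 1) / b"
  proof -
    have "((\<lambda>s. b powr (- s) * N s) has_field_derivative b powr (- 1) * N' + (- ln b * b powr (- 1)) * N 1) (at 1)"
    proof (rule DERIV_mult')
      show "((\<lambda>s. b powr (- s)) has_field_derivative - ln b * b powr (- 1)) (at 1)"
        unfolding powr_def using b by (auto intro!: derivative_eq_intros)
      show "(N has_field_derivative N') (at 1)"
        unfolding N_def N'_def using sech_mellin_deriv_1[OF assms(1) holQ] .
    qed
    moreover have "((\<lambda>s. b powr (- s) * N s) has_field_derivative L) (at 1)"
    proof -
      have "((\<lambda>s. LINT x:{0<..}|lborel. of_real x powr (s - 1) * sech (b * of_real x) ^ n) has_field_derivative L) (at 1)"
        using mellin(4)[OF assms(3)] unfolding cong L_def by simp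
      then show ?thesis
        by (rule has_field_derivative_transform_within_open[where S = "{s. Re s > 0}"])
          (use assms in \<open>auto simp: N_def open_halfspace_Re_gt intro!: sech_power_mellin(2)[OF _ _ holQ Q]\<close>)
    qed
    ultimately have "L = b powr (- 1) * N' + (- ln b * b powr (- 1)) * N 1" using DERIV_unique by blast
    then show ?thesis using b by (simp add: powr_minus field_simps)
  qed
  have split: "of_real (ln (a * x)) * sech (b * of_real x) ^ n = of_real (ln a) * sech (b * of_real x) ^ n + of_real (ln x) * sech (b * of_real x) ^ n"
    if "x \<in> {0<..}" for x
    using that assms by (simp add: ln_mult algebra_simps)
  have int1: "set_integrable lborel {0<..} (\<lambda>x. of_real (ln a) * sech (b * of_real x) ^ n)"
    using int by (rule set_integrable_mult_right)
  have "set_integrable lborel {0<..} (\<lambda>x. of_real (ln (a * x)) * sech (b * of_real x) ^ n)"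
    using set_integral_add(1)[OF int1 intln] by (rule set_integrable_cong[THEN iffD1, rotated -1]) (auto simp: split)
  moreover have "(LINT x:{0<..}|lborel. of_real (ln (a * x)) * sech (b * of_real x) ^ n)
     = 2 powi (int n - 2) * Gamma (of_nat n / 2) ^ 2 * ln (of_real a / b) / (b * fact (n - 1)) + N' / b"
  proof -
    have "(LINT x:{0<..}|lborel. of_real (ln (a * x)) * sech (b * of_real x) ^ n)
       = (LINT x:{0<..}|lborel. of_real (ln a) * sech (b * of_real x) ^ n + of_real (ln x) * sech (b * of_real x) ^ n)"
      by (intro set_lebesgue_integral_cong) (auto simp: split)
    also have "\<dots> = of_real (ln a) * I b + L"
      using set_integral_add(2)[OF int1 intln] by (simp add: I_def L_def)
    also have "\<dots> = N 1 * (of_real (ln a) - ln b) / b + N' / b"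
      unfolding I[OF assms(3)] L by (simp add: diff_divide_distrib algebra_simps)
    also have "of_real (ln a) - ln b = ln (of_real a / b)"
      using Ln_times_of_real[OF assms(2), of "inverse b"] b Ln_inverse[OF b(2)] assms(2) by (simp add: divide_inverse Ln_of_real)
    finally show ?thesis unfolding N1 by (simp add: mult_ac)
  qed
  moreover have "N' / b = 2 ^ (2 * n - 1) / (b * fact (n - 1)) *
       (\<Sum>k = 2..n + 1. (- 1 / 2) ^ k * stirling_poly (k - 2) (n - 1) (of_nat n / 2) *
          (hurwitz_zeta_diff 1 (of_nat k - of_nat n) (of_nat n / 4) (of_nat (n + 2) / 4)
           - (euler_mascheroni + ln 4) *
             hurwitz_zeta_diff 0 (of_nat k - of_nat n) (of_nat n / 4) (of_nat (n + 2) / 4)))"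
    using Q0 Q1 by (simp add: N'_def)
  ultimately show ?thesis by simp
qed

end
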